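(* Let $\Omega \subset \mathbb{R}^d$ be a nonempty bounded open set, let $m \le d$, and let $g_1,\dots,g_m \in C^2(\bar\Omega;\mathbb{R}^d)$ be vector fields. Let $\Delta_H$ be the associated sub-Laplacian on $L^2(\Omega)$, as defined in the context. Suppose the restriction of $\Delta_H$ to $L^2_\perp(\Omega)$ is injective, i.e. if $u \in L^2_\perp(\Omega)$ lies in the domain of $\Delta_H$ and $\Delta_H u = 0$, then $u = 0$. Then for every $R > 0$ and every $y \in \Omega$, the set $\mathrm{Reach}(B_R(y))$ has full Lebesgue measure in $\Omega$, i.e. $\Omega \setminus \mathrm{Reach}(B_R(y))$ has Lebesgue measure zero.
   Context: All functions are real-valued; $\langle\cdot,\cdot\rangle_2$ and $\|\cdot\|_2$ are the inner product and norm of $L^2(\Omega)$ with Lebesgue measure. $L^2_\perp(\Omega) = \{h \in L^2(\Omega) : \int_\Omega h\,dx = 0\}$. $B_R(y)$ is the open Euclidean ball in $\mathbb{R}^d$ of radius $R$ centred at $y$. Derivatives along vector fields: write $g_i = (g_i^1,\dots,g_i^d)$. For smooth $h$, $X_i h = \sum_{j=1}^d g_i^j \partial_{x_j} h$ and $X_i^* h = -\sum_{j=1}^d \partial_{x_j}(g_i^j h)$. A function $f \in L^2(\Omega)$ has weak derivative $X_i f = w \in L^2(\Omega)$ along $g_i$ if $\int_\Omega w\,\phi\,dx = \int_\Omega f\, X_i^*\phi\,dx$ for all $\phi \in C_0^\infty(\Omega)$ (smooth functions compactly supported in $\Omega$). Horizontal Sobolev space: $WH^1(\Omega) = \{u \in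 L^2(\Omega) : X_i u \in L^2(\Omega),\ i = 1,\dots,m\}$ with norm $\|u\|_2 + \sum_{i=1}^m \|X_i u\|_2$. Sub-Laplacian: formally $\Delta_H h = -\sum_{i=1}^m X_i^* X_i h$. Rigorously, let $\sigma(u,\phi) = \sum_{i=1}^m \int_\Omega X_i u\, X_i\phi\,dx$ for $u,\phi \in WH^1(\Omega)$. The domain of $\Delta_H$ is the set of $u \in WH^1(\Omega)$ for which there is $f \in L^2(\Omega)$ with $\sigma(u,\phi) = \langle f,\phi\rangle_2$ for all $\phi \in WH^1(\Omega)$; for such $u$, $\Delta_H u = -f$. Reachability: a trajectory in $\Omega$ is an absolutely continuous curve $\gamma:[0,1]\to\mathbb{R}^d$ with $\dot\gamma \in L^2(0,1;\mathbb{R}^d)$ and $\gamma(t) \in \Omega$ for all $t \in [0,1]$, for which there is a control $u \in L^2(0,1;\mathbb{R}^m)$ with $\dot\gamma(t) = \sum_{i=1}^m u_i(t) g_i(\gamma(t))$ for a.e. $t \in (0,1)$. For $B \subseteq \mathbb{R}^d$, the forward reachable set $\mathrm{Reach}(B)$ is the set of $z \in \Omega$ for which there is a trajectory $\gamma$ in $\Omega$ with $\gamma(0) \in B$ and $\gamma(1) = z$. *)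

theory Defs
  imports "HOL-Analysis.Analysis"
begin

definition partial_deriv ::
    "'d::finite \<Rightarrow> (real^'d \<Rightarrow> 'b::real_normed_vector) \<Rightarrow> real^'d \<Rightarrow> 'b" where
  "partial_deriv j f x = frechet_derivative f (at x) (axis j 1)"

text \<open>\<open>Ck_on k S f\<close> is meant for open \<open>S\<close>; only the values of \<open>f\<close> on \<open>S\<close> matter then.\<close>

primrec Ck_on :: "nat \<Rightarrow> (real^'d::finite) set \<Rightarrow> (real^'d \<Rightarrow> 'b::real_normed_vector) \<Rightarrow> bool" where
  "Ck_on 0 S f \<longleftrightarrow> continuous_on S f"
| "Ck_on (Suc k) S f \<longleftrightarrow>
     (\<forall>x\<in>S. f differentiable (at x)) \<and> (\<forall>j. Ck_on k S (partial_deriv j f))"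

definition extends_to_closure :: "'a::topological_space set \<Rightarrow> ('a \<Rightarrow> 'b::topological_space) \<Rightarrow> bool" where
  "extends_to_closure S f \<longleftrightarrow> (\<exists>F. continuous_on (closure S) F \<and> (\<forall>x\<in>S. F x = f x))"

text \<open>\<open>C\<^sup>2\<close> up to the boundary: all derivatives of order at most two exist in the open set and
  extend continuously to its closure.  The boundary values of \<open>f\<close> itself are irrelevant.\<close>

definition C2_closure :: "(real^'d::finite) set \<Rightarrow> (real^'d \<Rightarrow> 'b::real_normed_vector) \<Rightarrow> bool" where
  "C2_closure \<Omega> f \<longleftrightarrow> Ck_on 2 \<Omega> f \<and> extends_to_closure \<Omega> f \<and>
     (\<forall>j. extends_to_closure \<Omega> (partial_deriv j f)) \<and>
     (\<forall>j k. extends_to_closure \<Omega> (partial_deriv k (partial_deriv j f)))"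

definition test_functions :: "(real^'d::finite) set \<Rightarrow> (real^'d \<Rightarrow> real) set" where
  "test_functions \<Omega> = {\<phi>. (\<forall>k. Ck_on k UNIV \<phi>) \<and>
     compact (closure {x. \<phi> x \<noteq> 0}) \<and> closure {x. \<phi> x \<noteq> 0} \<subseteq> \<Omega>}"

text \<open>Elements of \<open>L\<^sup>2\<close> are represented by functions, so equality in \<open>L\<^sup>2\<close> is equality
  almost everywhere.\<close>

definition L2_space :: "'a::euclidean_space set \<Rightarrow> ('a \<Rightarrow> 'b::euclidean_space) set" where
  "L2_space S = {f \<in> borel_measurable (lebesgue_on S).
     integrable (lebesgue_on S) (\<lambda>x. (norm (f x))\<^sup>2)}"

definition L2_inner :: "'a::euclidean_space set \<Rightarrow> ('a \<Rightarrow> real) \<Rightarrow> ('a \<Rightarrow> real) \<Rightarrow> real" where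
  "L2_inner S f h = (LINT x|lebesgue_on S. f x * h x)"

definition L2_perp :: "'a::euclidean_space set \<Rightarrow> ('a \<Rightarrow> real) set" where
  "L2_perp S = {h \<in> L2_space S. (LINT x|lebesgue_on S. h x) = 0}"

definition field_adjoint ::
    "(real^'d::finite \<Rightarrow> real^'d) \<Rightarrow> (real^'d \<Rightarrow> real) \<Rightarrow> real^'d \<Rightarrow> real" where
  "field_adjoint X h x = - (\<Sum>j\<in>UNIV. partial_deriv j (\<lambda>y. X y $ j * h y) x)"

definition has_weak_deriv :: "(real^'d::finite) set \<Rightarrow> (real^'d \<Rightarrow> real^'d) \<Rightarrow>
    (real^'d \<Rightarrow> real) \<Rightarrow> (real^'d \<Rightarrow> real) \<Rightarrow> bool" where
  "has_weak_deriv \<Omega> X f w \<longleftrightarrow> f \<in> L2_space \<Omega> \<and> w \<in> L2_space \<Omega> \<and>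
     (\<forall>\<phi>\<in>test_functions \<Omega>.
        (LINT x|lebesgue_on \<Omega>. w x * \<phi> x) = (LINT x|lebesgue_on \<Omega>. f x * field_adjoint X \<phi> x))"

definition WH1 :: "(real^'d::finite) set \<Rightarrow> ('m::finite \<Rightarrow> real^'d \<Rightarrow> real^'d) \<Rightarrow>
    (real^'d \<Rightarrow> real) set" where
  "WH1 \<Omega> g = {u \<in> L2_space \<Omega>. \<forall>i. \<exists>w. has_weak_deriv \<Omega> (g i) u w}"

text \<open>\<open>has_sigma \<Omega> g u \<phi> s\<close> says that \<open>\<sigma>(u,\<phi>) = s\<close>.  A weak derivative is determined almost
  everywhere, so the choice of representatives \<open>w\<close> and \<open>v\<close> does not affect \<open>s\<close>, and for
  \<open>u\<close> and \<open>\<phi>\<close> in \<open>WH1 \<Omega> g\<close> there is exactly one such \<open>s\<close>.\<close>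

definition has_sigma :: "(real^'d::finite) set \<Rightarrow> ('m::finite \<Rightarrow> real^'d \<Rightarrow> real^'d) \<Rightarrow>
    (real^'d \<Rightarrow> real) \<Rightarrow> (real^'d \<Rightarrow> real) \<Rightarrow> real \<Rightarrow> bool" where
  "has_sigma \<Omega> g u \<phi> s \<longleftrightarrow> (\<exists>w v.
     (\<forall>i. has_weak_deriv \<Omega> (g i) u (w i) \<and> has_weak_deriv \<Omega> (g i) \<phi> (v i)) \<and>
     s = (\<Sum>i\<in>UNIV. LINT x|lebesgue_on \<Omega>. w i x * v i x))"

text \<open>\<open>has_sub_laplacian \<Omega> g u h\<close> says that \<open>u\<close> lies in the domain of the sub-Laplacian and that
  its sub-Laplacian is (the class of) \<open>h\<close>.\<close>

definition has_sub_laplacian :: "(real^'d::finite) set \<Rightarrow> ('m::finite \<Rightarrow> real^'d \<Rightarrow> real^'d) \<Rightarrow>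
    (real^'d \<Rightarrow> real) \<Rightarrow> (real^'d \<Rightarrow> real) \<Rightarrow> bool" where
  "has_sub_laplacian \<Omega> g u h \<longleftrightarrow> u \<in> WH1 \<Omega> g \<and> h \<in> L2_space \<Omega> \<and>
     (\<exists>f\<in>L2_space \<Omega>. (\<forall>\<phi>\<in>WH1 \<Omega> g. has_sigma \<Omega> g u \<phi> (L2_inner \<Omega> f \<phi>)) \<and>
        (AE x in lebesgue_on \<Omega>. h x = - f x))"

text \<open>A finite set \<open>D\<close> of pairs \<open>(a, b)\<close> encodes a finite family of non-overlapping
  subintervals of \<open>S\<close>.\<close>

definition abs_continuous_on :: "real set \<Rightarrow> (real \<Rightarrow> 'b::real_normed_vector) \<Rightarrow> bool" where
  "abs_continuous_on S f \<longleftrightarrow> (\<forall>\<epsilon>>0. \<exists>\<delta>>0. \<forall>D. finite D \<longrightarrow>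
     (\<forall>(a, b)\<in>D. a \<le> b \<and> {a..b} \<subseteq> S) \<longrightarrow>
     disjoint_family_on (\<lambda>(a, b). {a<..<b}) D \<longrightarrow>
     (\<Sum>(a, b)\<in>D. b - a) < \<delta> \<longrightarrow> (\<Sum>(a, b)\<in>D. norm (f b - f a)) < \<epsilon>)"

definition trajectory_in :: "(real^'d::finite) set \<Rightarrow> ('m::finite \<Rightarrow> real^'d \<Rightarrow> real^'d) \<Rightarrow>
    (real \<Rightarrow> real^'d) \<Rightarrow> bool" where
  "trajectory_in \<Omega> g \<gamma> \<longleftrightarrow> abs_continuous_on {0..1} \<gamma> \<and> (\<forall>t\<in>{0..1}. \<gamma> t \<in> \<Omega>) \<and>
     (\<exists>\<gamma>' \<in> L2_space {0<..<1}. \<exists>u :: real \<Rightarrow> real^'m. u \<in> L2_space {0<..<1} \<and>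
        (AE t in lebesgue_on {0<..<1}. (\<gamma> has_vector_derivative \<gamma>' t) (at t) \<and>
           \<gamma>' t = (\<Sum>i\<in>UNIV. u t $ i *\<^sub>R g i (\<gamma> t))))"

definition Reach :: "(real^'d::finite) set \<Rightarrow> ('m::finite \<Rightarrow> real^'d \<Rightarrow> real^'d) \<Rightarrow>
    (real^'d) set \<Rightarrow> (real^'d) set" where
  "Reach \<Omega> g B = {z \<in> \<Omega>. \<exists>\<gamma>. trajectory_in \<Omega> g \<gamma> \<and> \<gamma> 0 \<in> B \<and> \<gamma> 1 = z}"

end

theory Submission
  imports Defs
begin

text \<open>
  Let \<open>A\<close> be the interior of the set of points that can be reached from the ball with bounded
  controls, and let \<open>c\<close> be the fraction of the volume of \<open>\<Omega>\<close> that \<open>A\<close> takes up.  The indicator of \<open>A\<close>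
  is constant along the flow lines of the fields, because these can be run forwards and backwards.  So
  \<open>u = 1\<^sub>A - c\<close> should have vanishing derivatives along all \<open>g\<^sub>i\<close>, hence a vanishing
  sub-Laplacian; it has mean zero, so the injectivity assumption gives \<open>u = 0\<close> almost everywhere.  As
  \<open>A\<close> contains a neighbourhood of \<open>y\<close>, this forces \<open>c = 1\<close>, and \<open>A\<close> has full measure.

  The work lies in showing that the weak derivatives vanish.  Unfolding the adjoint, this says that
  the divergence of \<open>Y = \<phi> g\<^sub>i\<close> integrates to zero over \<open>A\<close> and over \<open>\<Omega>\<close>, for every test function
  \<open>\<phi>\<close>.  The field \<open>Y\<close> is \<open>C\<^sup>2\<close> with compact support in \<open>\<Omega>\<close>, and its flow is a reparametrised motion
  along \<open>\<plusminus>g\<^sub>i\<close>, so the flow preserves both sets (\<open>flow_invariant_interior_steered_set\<close>,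
  \<open>flow_invariant_whole\<close>).  A flow that preserves a set of finite volume cannot change its volume to
  first order, and the first order change is the integral of the divergence
  (\<open>divergence_integral_zero\<close>).

  Working with the interior makes openness, hence measurability, free of charge: the time-\<open>h\<close> flow map
  is continuous and injective, so by invariance of domain it maps the interior onto an open set
  (\<open>interior_invariant\<close>).

  The first order volume estimate is obtained without differentiating the flow with respect to its
  starting point.  Let \<open>\<Psi>\<close> be the time-\<open>h\<close> flow of \<open>-Y\<close> and \<open>E x = x + h Y x\<close> the Euler step of \<open>Y\<close>.
  Then \<open>E \<circ> \<Psi>\<close> differs from the identity by a map whose Lipschitz constant is \<open>O(h\<^sup>2)\<close>
  (\<open>euler_step_of_backward_flow_close\<close>), so its inverse expands volumes at most by a factor
  \<open>1 + O(h\<^sup>2)\<close> (\<open>emeasure_Lipschitz_image_le\<close>).  Since \<open>\<Psi>\<close> maps \<open>A\<close> into \<open>A\<close>, the volume of \<open>A\<close> is at most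
  \<open>1 + O(h\<^sup>2)\<close> times that of \<open>E ` A\<close>, which the explicit Jacobian of \<open>E\<close> bounds by
  \<open>|A| + h \<integral>\<^sub>A div Y + O(h\<^sup>2)\<close> (\<open>measure_perturbed_identity_image\<close>).  Dividing by \<open>h\<close> gives
  \<open>0 \<le> \<integral>\<^sub>A div Y\<close>, and the same for \<open>-Y\<close> gives equality.
\<close>

section \<open>Volumes of Lipschitz images\<close>

text \<open>
  A Lipschitz map sends a ball of radius \<open>r\<close> into a ball of radius \<open>K r\<close>, whose volume is \<open>K\<^sup>d\<close> times
  as large.  By Vitali's covering theorem an open set is a disjoint union of balls up to a null set,
  and Lipschitz maps preserve null sets.
\<close>
lemma emeasure_Lipschitz_image_le:
  fixes f :: "'a::euclidean_space \<Rightarrow> 'a"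
  assumes "open U" and lip: "K-lipschitz_on U f" and K: "K > 0" and meas: "f ` U \<in> sets lebesgue"
  shows "emeasure lebesgue (f ` U) \<le> ennreal (K ^ DIM('a)) * emeasure lebesgue U"
proof -
  define I where "I = {(x, r). x \<in> U \<and> r > 0 \<and> ball x r \<subseteq> U}"
  have "\<exists>i. i \<in> I \<and> x \<in> ball (fst i) (snd i) \<and> snd i < d" if x: "x \<in> U" and d: "0 < d" for x d
  proof -
    obtain r where r: "r > 0" "ball x r \<subseteq> U"
      using \<open>open U\<close> x open_contains_ball by blast
    have "ball x (min r (d/2)) \<subseteq> ball x r" by (simp add: subset_ball)
    then show ?thesis using r d x by (intro exI[of _ "(x, min r (d/2))"]) (auto simp: I_def)
  qed
  then obtain C where C: "countable C" "C \<subseteq> I"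
    "pairwise (\<lambda>i j. disjnt (ball (fst i) (snd i)) (ball (fst j) (snd j))) C"
    "negligible (U - (\<Union>i\<in>C. ball (fst i) (snd i)))"
    using Vitali_covering_theorem_balls[of U I fst snd] by blast
  define N where "N = U - (\<Union>i\<in>C. ball (fst i) (snd i))"
  have "negligible (f ` N)"
  proof (rule negligible_locally_Lipschitz_image)
    show "negligible N" using C by (simp add: N_def)
    fix x assume "x \<in> N"
    have "norm (f y - f x) \<le> K * norm (y - x)" if "y \<in> N" for y
      using lipschitz_onD[OF lip, of y x] that \<open>x \<in> N\<close> by (simp add: dist_norm N_def)
    then show "\<exists>T B. open T \<and> x \<in> T \<and> (\<forall>y\<in>N \<inter> T. norm (f y - f x) \<le> B * norm (y - x))"
      by (intro exI[of _ UNIV] exI[of _ K]) auto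
  qed simp
  then have N0: "emeasure lebesgue (f ` N) = 0" "f ` N \<in> sets lebesgue"
    unfolding negligible_iff_null_sets by (rule null_setsD1, rule null_setsD2)
  \<comment> \<open>The countable family \<open>C\<close> may be finite or empty, so it is padded with empty sets to a sequence.\<close>
  define V where "V n = (if n \<in> to_nat_on C ` C then ball (fst (from_nat_into C n)) (snd (from_nat_into C n)) else {})" for n
  define W where "W n = (if n \<in> to_nat_on C ` C then cball (f (fst (from_nat_into C n))) (K * snd (from_nat_into C n)) else {})" for n
  have CI: "fst i \<in> U" "snd i > 0" "ball (fst i) (snd i) \<subseteq> U" if "i \<in> C" for i
    using subsetD[OF C(2) that] by (auto simp: I_def split: prod.splits)
  have UV: "(\<Union>i\<in>C. ball (fst i) (snd i)) = (\<Union>n. V n)"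
    using C(1) by (auto simp: V_def split: if_splits)
  have sub: "f ` U \<subseteq> f ` N \<union> (\<Union>n. W n)"
  proof
    fix y assume "y \<in> f ` U"
    then obtain x where x: "x \<in> U" "y = f x" by auto
    show "y \<in> f ` N \<union> (\<Union>n. W n)"
    proof (cases "x \<in> N")
      case False
      then obtain i where i: "i \<in> C" "x \<in> ball (fst i) (snd i)" using x by (auto simp: N_def)
      have "dist (f (fst i)) (f x) \<le> K * dist (fst i) x"
        using lipschitz_onD[OF lip, of "fst i" x] x CI i by auto
      also have "\<dots> \<le> K * snd i" using i K by (intro mult_left_mono) auto
      finally have "y \<in> W (to_nat_on C i)" using i x C(1) by (simp add: W_def)
      then show ?thesis by auto
    qed (use x in auto)
  qed
  have WV: "emeasure lebesgue (W n) = ennreal (K ^ DIM('a)) * emeasure lebesgue (V n)" for n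
  proof (cases "n \<in> to_nat_on C ` C")
    case True
    then have "from_nat_into C n \<in> C" using C(1) by auto
    from CI[OF this] show ?thesis using True K
      by (simp add: W_def V_def emeasure_cball emeasure_ball power_mult_distrib ennreal_mult[symmetric] mult_ac)
  qed (simp add: W_def V_def)
  have disj: "disjoint_family V"
    using C(1,3) by (fastforce simp: disjoint_family_on_def pairwise_def disjnt_def V_def)
  have mV: "range V \<subseteq> sets lebesgue" and mW: "range W \<subseteq> sets lebesgue" by (auto simp: V_def W_def)
  have "emeasure lebesgue (f ` U) \<le> emeasure lebesgue (f ` N \<union> (\<Union>n. W n))"
    using N0 mW by (intro emeasure_mono sub sets.Un sets.countable_UN) auto
  also have "\<dots> \<le> emeasure lebesgue (f ` N) + emeasure lebesgue (\<Union>n. W n)"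
    using N0 mW by (intro emeasure_subadditive sets.countable_UN) auto
  also have "\<dots> = emeasure lebesgue (\<Union>n. W n)" using N0 by simp
  also have "\<dots> \<le> (\<Sum>n. emeasure lebesgue (W n))"
    by (rule emeasure_subadditive_countably[OF mW])
  also have "\<dots> = ennreal (K ^ DIM('a)) * (\<Sum>n. emeasure lebesgue (V n))"
    by (simp add: WV)
  also have "(\<Sum>n. emeasure lebesgue (V n)) = emeasure lebesgue (\<Union>n. V n)"
    by (rule suminf_emeasure[OF mV disj])
  also have "\<dots> \<le> emeasure lebesgue U"
  proof (rule emeasure_mono)
    show "(\<Union>n. V n) \<subseteq> U" unfolding UV[symmetric] using CI(3) by (rule UN_least)
  qed (use \<open>open U\<close> in auto)
  finally show ?thesis by (simp add: mult_left_mono)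
qed

section \<open>Volumes under perturbations of the identity\<close>

text \<open>
  For negative \<open>x\<close> the reciprocal is bounded below by the Taylor polynomial of \<open>exp (- x)\<close>, and the
  product of the two polynomials is at least one.
\<close>
lemma exp_le_quadratic:
  fixes x :: real
  assumes "\<bar>x\<bar> \<le> 1"
  shows "exp x \<le> 1 + x + x\<^sup>2"
proof (cases "x \<ge> 0")
  case True
  then show ?thesis using assms exp_bound by auto
next
  case False
  have "1 \<le> (1 + x + x\<^sup>2) * (1 + (-x) + (-x)\<^sup>2 / 2)"
  proof -
    have "(1 + x + x\<^sup>2) * (1 + (-x) + (-x)\<^sup>2 / 2) = 1 + x^2/2 + x^2 * (-x) / 2 + x^4/2"
      by (simp add: field_simps power2_eq_square power4_eq_xxxx)
    moreover have "x^2 * (-x) \<ge> 0" using False by (intro mult_nonneg_nonneg) auto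
    moreover have "x^4 \<ge> 0" by simp
    moreover have "x^2 \<ge> 0" by simp
    ultimately show ?thesis by linarith
  qed
  also have "\<dots> \<le> (1 + x + x\<^sup>2) * exp (-x)"
    using False assms exp_lower_Taylor_quadratic[of "-x"] by (intro mult_left_mono) auto
  finally show ?thesis by (simp add: exp_minus field_simps)
qed

text \<open>
  The trace is the first order term of the determinant at the identity.  In the Leibniz formula every
  permutation other than the identity moves at least two indices, so its product contains two
  off-diagonal factors of size \<open>h K\<close>; the diagonal product is at most the exponential of \<open>h\<close> times
  the trace.
\<close>
lemma abs_det_perturbed_identity_le:
  fixes A :: "real^'n::finite^'n"
  assumes A: "\<And>i j. \<bar>A $ i $ j\<bar> \<le> K" and h: "h \<ge> 0" "h * K * CARD('n) \<le> 1"
  shows "\<bar>det (mat 1 + h *\<^sub>R A)\<bar> \<le> 1 + h * (\<Sum>i\<in>UNIV. A $ i $ i)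
    + (K\<^sup>2 * ((CARD('n))\<^sup>2 + 2 ^ CARD('n) * fact (CARD('n)))) * h\<^sup>2"
proof -
  let ?n = "CARD('n)" and ?U = "UNIV :: 'n set"
  define E where "E = mat 1 + h *\<^sub>R A"
  have K0: "K \<ge> 0" using A[of undefined undefined] by linarith
  have hK: "0 \<le> h * K" "h * K \<le> 1"
  proof -
    show "0 \<le> h * K" using K0 h by simp
    have "h * K * 1 \<le> h * K * ?n" using \<open>0 \<le> h * K\<close> by (intro mult_left_mono) (auto simp: Suc_leI)
    then show "h * K \<le> 1" using h by linarith
  qed
  have hA: "\<bar>h * A $ i $ j\<bar> \<le> h * K" for i j
    using A[of i j] h by (simp add: abs_mult mult_left_mono)
  have E: "E $ i $ j = (if i = j then 1 else 0) + h * A $ i $ j" for i j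
    by (simp add: E_def mat_def)
  have E2: "\<bar>E $ i $ j\<bar> \<le> 2" for i j using hA[of i j] hK by (auto simp: E)
  let ?P = "{p. p permutes ?U}"
  have finP: "finite ?P" by (simp add: finite_permutations)
  have off: "\<bar>of_int (sign p) * (\<Prod>i\<in>?U. E $ i $ p i)\<bar> \<le> K\<^sup>2 * h\<^sup>2 * 2 ^ ?n" if p: "p permutes ?U" "p \<noteq> id" for p
  proof -
    obtain a where a: "p a \<noteq> a" using p by (auto simp: fun_eq_iff)
    define b where "b = p a"
    have b: "p b \<noteq> b" "b \<noteq> a" using a p(1) permutes_inj[of p ?U] by (auto simp: b_def inj_def)
    have "\<bar>of_int (sign p) * (\<Prod>i\<in>?U. E $ i $ p i)\<bar> = (\<Prod>i\<in>?U. \<bar>E $ i $ p i\<bar>)"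
      by (simp add: abs_mult sign_def abs_prod)
    also have "\<dots> = \<bar>E $ a $ p a\<bar> * (\<bar>E $ b $ p b\<bar> * (\<Prod>i\<in>?U - {a} - {b}. \<bar>E $ i $ p i\<bar>))"
      using b by (subst prod.remove[of _ a]; simp) (subst prod.remove[of _ b]; simp)
    also have "\<dots> \<le> (h * K) * ((h * K) * 2 ^ ?n)"
    proof (intro mult_mono mult_nonneg_nonneg prod_nonneg)
      have "(\<Prod>i\<in>?U - {a} - {b}. \<bar>E $ i $ p i\<bar>) \<le> (\<Prod>i\<in>?U - {a} - {b}. 2)"
        by (rule prod_mono) (use E2 in auto)
      also have "\<dots> \<le> 2 ^ ?n" by (simp add: card_mono)
      finally show "(\<Prod>i\<in>?U - {a} - {b}. \<bar>E $ i $ p i\<bar>) \<le> 2 ^ ?n" .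
    qed (use hK hA h(1) K0 a b in \<open>auto simp: E\<close>)
    finally show ?thesis by (simp add: power2_eq_square mult_ac)
  qed
  define s where "s = h * (\<Sum>i\<in>?U. A $ i $ i)"
  have s_le: "\<bar>s\<bar> \<le> h * K * ?n"
  proof -
    have "\<bar>s\<bar> \<le> (\<Sum>i\<in>?U. \<bar>h * A $ i $ i\<bar>)" by (simp add: s_def sum_distrib_left)
    also have "\<dots> \<le> (\<Sum>i\<in>?U. h * K)" by (intro sum_mono hA)
    finally show ?thesis by (simp add: mult_ac)
  qed
  have diag: "\<bar>\<Prod>i\<in>?U. E $ i $ i\<bar> \<le> 1 + s + K\<^sup>2 * (real ?n)\<^sup>2 * h\<^sup>2"
  proof -
    have nn: "0 \<le> E $ i $ i" for i using hA[of i i] hK by (auto simp: E)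
    then have "\<bar>\<Prod>i\<in>?U. E $ i $ i\<bar> = (\<Prod>i\<in>?U. E $ i $ i)" by (simp add: prod_nonneg)
    also have "\<dots> \<le> (\<Prod>i\<in>?U. exp (h * A $ i $ i))"
      using nn by (intro prod_mono) (auto simp: E)
    also have "\<dots> = exp s" by (simp add: s_def sum_distrib_left exp_sum)
    also have "\<dots> \<le> 1 + s + s\<^sup>2" using s_le h by (intro exp_le_quadratic) linarith
    also have "s\<^sup>2 \<le> (h * K * ?n)\<^sup>2" using s_le by (simp add: abs_le_square_iff[symmetric])
    finally show ?thesis by (simp add: power_mult_distrib mult_ac)
  qed
  have "\<bar>det E\<bar> \<le> (\<Sum>p\<in>?P. \<bar>of_int (sign p) * (\<Prod>i\<in>?U. E $ i $ p i)\<bar>)"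
    unfolding det_def by (rule sum_abs)
  also have "\<dots> = \<bar>\<Prod>i\<in>?U. E $ i $ i\<bar> + (\<Sum>p\<in>?P - {id}. \<bar>of_int (sign p) * (\<Prod>i\<in>?U. E $ i $ p i)\<bar>)"
    using finP by (subst sum.remove[of _ id]) (auto simp: permutes_id)
  also have "(\<Sum>p\<in>?P - {id}. \<bar>of_int (sign p) * (\<Prod>i\<in>?U. E $ i $ p i)\<bar>) \<le> (\<Sum>p\<in>?P - {id}. K\<^sup>2 * h\<^sup>2 * 2 ^ ?n)"
    by (rule sum_mono) (use off in auto)
  also have "\<dots> \<le> (\<Sum>p\<in>?P. K\<^sup>2 * h\<^sup>2 * 2 ^ ?n)"
    by (rule sum_mono2) (use finP in auto)
  also have "\<dots> = fact ?n * (K\<^sup>2 * h\<^sup>2 * 2 ^ ?n)"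
    by (simp add: card_permutations)
  finally have "\<bar>det E\<bar> \<le> \<bar>\<Prod>i\<in>?U. E $ i $ i\<bar> + fact ?n * (K\<^sup>2 * h\<^sup>2 * 2 ^ ?n)" by simp
  with diag show ?thesis
    by (simp add: E_def[symmetric] s_def[symmetric] algebra_simps)
qed

text \<open>
  The coefficient of the quadratic remainder in \<open>abs_det_perturbed_identity_le\<close>: the squared trace in
  the exponential and the products of the \<open>n!\<close> permutations, whose other factors are at most two.
\<close>
definition jacobian_constant :: "nat \<Rightarrow> real \<Rightarrow> real" where
  "jacobian_constant n K = K\<^sup>2 * (n\<^sup>2 + 2 ^ n * fact n)"

text \<open>
  This is the area formula followed by the expansion of the Jacobian.  The area formula is stated for
  well-ordered index types.
\<close>
lemma measure_perturbed_identity_image_ordered: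
  fixes Y :: "real^'n::{finite,wellorder} \<Rightarrow> real^'n::_" and S :: "(real^'n::_) set"
  assumes S: "open S" "bounded S"
    and D: "\<And>x. (Y has_derivative D x) (at x)"
    and K: "\<And>x i j. \<bar>D x (axis j 1) $ i\<bar> \<le> K"
    and cont: "continuous_on UNIV (\<lambda>x. \<Sum>i\<in>UNIV. D x (axis i 1) $ i)"
    and h: "h \<ge> 0" "h * K * CARD('n) \<le> 1"
  shows "measure lebesgue ((\<lambda>x. x + h *\<^sub>R Y x) ` S) \<le>
    (LINT x|lborel. indicator S x * (1 + h * (\<Sum>i\<in>UNIV. D x (axis i 1) $ i) + jacobian_constant CARD('n) K * h\<^sup>2))"
proof -
  let ?E = "\<lambda>x. x + h *\<^sub>R Y x" and ?D = "\<lambda>x v. v + h *\<^sub>R D x v"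
  define c where "c = jacobian_constant CARD('n) K"
  define F where "F x = 1 + h * (\<Sum>i\<in>UNIV. D x (axis i 1) $ i) + c * h\<^sup>2" for x
  have Slm: "S \<in> lmeasurable" using S by (simp add: bounded_set_imp_lmeasurable)
  have der: "(?E has_derivative ?D x) (at x within S)" for x
    using has_derivative_at_withinI[OF D, of x S] by (auto intro!: derivative_eq_intros)
  have mat: "matrix (?D x) = mat 1 + h *\<^sub>R matrix (D x)" for x
    by (simp add: matrix_def mat_def vec_eq_iff axis_def)
  have det: "\<bar>det (matrix (?D x))\<bar> \<le> F x" for x
    unfolding mat F_def c_def jacobian_constant_def
    using abs_det_perturbed_identity_le[of "matrix (D x)" K h] K h by (simp add: matrix_def)
  have contF: "continuous_on UNIV F"
    unfolding F_def by (intro continuous_intros cont)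
  have "compact (F ` closure S)"
    using S by (intro compact_continuous_image continuous_on_subset[OF contF]) auto
  then obtain B where "\<forall>y\<in>F ` closure S. norm y \<le> B"
    by (meson bounded_iff compact_imp_bounded)
  then have B: "norm (F x) \<le> B" if "x \<in> S" for x
    using closure_subset[of S] that by auto
  have intF': "integrable lborel (\<lambda>x. indicator S x *\<^sub>R F x)"
  proof (rule integrableI_bounded_set_indicator[where B = B])
    show "emeasure lborel S < \<infinity>" using S emeasure_bounded_finite[of S] by (simp add: less_top[symmetric])
  qed (use S B contF in \<open>auto intro: borel_measurable_continuous_onI\<close>)
  have aiF: "F absolutely_integrable_on S"
    unfolding set_integrable_def using intF' by (simp add: integrable_completion)
  then have intF: "F integrable_on S" by (rule set_lebesgue_integral_eq_integral(1))
  have det_int: "(\<lambda>x. \<bar>det (matrix (?D x))\<bar>) integrable_on S"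
  proof (rule measurable_bounded_by_integrable_imp_integrable[OF _ intF])
    show "(\<lambda>x. \<bar>det (matrix (?D x))\<bar>) \<in> borel_measurable (lebesgue_on S)"
      using borel_measurable_det_Jacobian[OF _ der] S by auto
  qed (use det S in auto)
  have "measure lebesgue (?E ` S) \<le> integral S (\<lambda>x. \<bar>det (matrix (?D x))\<bar>)"
    by (rule measure_differentiable_image[OF _ der det_int]) (use S in auto)
  also have "\<dots> \<le> integral S F"
    by (rule integral_le[OF det_int intF]) (use det in auto)
  also have "\<dots> = (LINT x|lebesgue. indicator S x *\<^sub>R F x)"
    using set_lebesgue_integral_eq_integral(2)[OF aiF] by (simp add: set_lebesgue_integral_def)
  also have "\<dots> = (LINT x|lborel. indicator S x *\<^sub>R F x)"
    using intF' by (intro integral_completion) auto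
  finally show ?thesis by (simp add: F_def c_def)
qed

section \<open>Index types without an order\<close>

text \<open>
  The area formula is stated for well-ordered index types.  Every finite type has a copy that carries
  such an order, transported from an enumeration; relabelling the coordinates is a
  volume-preserving linear bijection onto the space indexed by that copy.
\<close>
typedef 'a ordered_copy = "UNIV :: 'a set" by auto

lemma Rep_Abs_ordered_copy [simp]: "Rep_ordered_copy (Abs_ordered_copy x) = x"
  by (simp add: Abs_ordered_copy_inverse)

declare Rep_ordered_copy_inverse [simp]

lemma bij_Rep_ordered_copy: "bij Rep_ordered_copy"
  by (rule o_bij[of Abs_ordered_copy]) auto

instance ordered_copy :: (finite) finite
proof
  have "bij_betw Rep_ordered_copy (UNIV :: 'a ordered_copy set) UNIV"
    using bij_Rep_ordered_copy by simp
  then show "finite (UNIV :: 'a ordered_copy set)"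
    by (simp add: bij_betw_finite)
qed

instantiation ordered_copy :: (finite) wellorder
begin

definition less_eq_ordered_copy :: "'a ordered_copy \<Rightarrow> 'a ordered_copy \<Rightarrow> bool" where
  "x \<le> y \<longleftrightarrow> to_nat_on UNIV (Rep_ordered_copy x) \<le> to_nat_on UNIV (Rep_ordered_copy y)"

definition less_ordered_copy :: "'a ordered_copy \<Rightarrow> 'a ordered_copy \<Rightarrow> bool" where
  "x < y \<longleftrightarrow> to_nat_on UNIV (Rep_ordered_copy x) < to_nat_on UNIV (Rep_ordered_copy y)"

instance
proof
  fix x y :: "'a ordered_copy"
  assume "x \<le> y" "y \<le> x"
  then have "to_nat_on UNIV (Rep_ordered_copy x) = to_nat_on UNIV (Rep_ordered_copy y)"
    by (simp add: less_eq_ordered_copy_def)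
  then have "Rep_ordered_copy x = Rep_ordered_copy y"
    by (metis UNIV_I countable_finite finite_code from_nat_into_to_nat_on)
  then show "x = y" by (simp add: Rep_ordered_copy_inject)
next
  fix P :: "'a ordered_copy \<Rightarrow> bool" and a :: "'a ordered_copy"
  assume *: "\<And>x. (\<And>y. y < x \<Longrightarrow> P y) \<Longrightarrow> P x"
  show "P a"
    by (induction a rule: measure_induct_rule[where f = "\<lambda>x. to_nat_on UNIV (Rep_ordered_copy x)"])
      (rule *, simp add: less_ordered_copy_def)
qed (auto simp: less_eq_ordered_copy_def less_ordered_copy_def)

end

definition relabel :: "real^'d \<Rightarrow> real^'d ordered_copy" where
  "relabel x = (\<chi> i. x $ Rep_ordered_copy i)"

definition unlabel :: "real^'d ordered_copy \<Rightarrow> real^'d" where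
  "unlabel y = (\<chi> i. y $ Abs_ordered_copy i)"

lemma relabel_unlabel [simp]: "relabel (unlabel y) = y" "unlabel (relabel x) = x"
  by (simp_all add: relabel_def unlabel_def)

lemma linear_relabel: "linear (relabel :: real^'d::finite \<Rightarrow> _)"
  and linear_unlabel: "linear (unlabel :: real^'d::finite ordered_copy \<Rightarrow> _)"
  by (auto intro!: linearI simp: relabel_def unlabel_def vec_eq_iff)

lemma continuous_on_relabel [continuous_intros]:
  "continuous_on S (relabel :: real^'d::finite \<Rightarrow> _)" "continuous_on T (unlabel :: real^'d::finite ordered_copy \<Rightarrow> _)"
  using linear_relabel linear_unlabel by (auto intro!: linear_continuous_on simp: linear_linear)

lemma measurable_relabel [measurable]:
  "(relabel :: real^'d::finite \<Rightarrow> _) \<in> borel_measurable borel"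
  "(unlabel :: real^'d::finite ordered_copy \<Rightarrow> _) \<in> borel_measurable borel"
  by (auto intro!: borel_measurable_continuous_onI continuous_intros)

lemma prod_Basis_cart: "(\<Prod>b\<in>Basis. f b) = (\<Prod>i\<in>UNIV. f (axis i 1 :: real^'n))"
proof -
  have "(Basis :: (real^'n) set) = range (\<lambda>i. axis i 1 :: real^'n)" by (auto simp: Basis_vec_def)
  moreover have "inj (\<lambda>i. axis i 1 :: real^'n)" by (auto simp: inj_on_def axis_eq_axis)
  ultimately show ?thesis by (metis (no_types, lifting) prod.reindex_cong)
qed

lemma distr_lborel_relabel: "distr lborel borel (relabel :: real^'d::finite \<Rightarrow> _) = lborel"
proof (rule lborel_eqI[symmetric])
  fix l u :: "real^'d ordered_copy"
  assume le: "\<And>b. b \<in> Basis \<Longrightarrow> l \<bullet> b \<le> u \<bullet> b"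
  have le': "l $ i \<le> u $ i" for i using le[of "axis i 1"] by (simp add: inner_axis)
  have "relabel -` box l u = box (unlabel l) (unlabel u)"
  proof (intro set_eqI iffI)
    fix x :: "real^'d" assume "x \<in> relabel -` box l u"
    then have "l $ Abs_ordered_copy i < x $ i \<and> x $ i < u $ Abs_ordered_copy i" for i
      by (auto simp: mem_box_cart relabel_def dest: spec[of _ "Abs_ordered_copy i"])
    then show "x \<in> box (unlabel l) (unlabel u)" by (simp add: mem_box_cart unlabel_def)
  next
    fix x :: "real^'d" assume "x \<in> box (unlabel l) (unlabel u)"
    then have "unlabel l $ Rep_ordered_copy i < x $ Rep_ordered_copy i \<and> x $ Rep_ordered_copy i < unlabel u $ Rep_ordered_copy i" for i
      by (auto simp: mem_box_cart)
    then show "x \<in> relabel -` box l u" by (simp add: mem_box_cart unlabel_def relabel_def)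
  qed
  then have "emeasure (distr lborel borel relabel) (box l u) = emeasure lborel (box (unlabel l) (unlabel u))"
    by (simp add: emeasure_distr)
  also have "\<dots> = (\<Prod>b\<in>Basis. (unlabel u - unlabel l) \<bullet> b)"
    by (subst emeasure_lborel_box) (auto simp: Basis_vec_def inner_axis unlabel_def le')
  also have "(\<Prod>b\<in>Basis. (unlabel u - unlabel l) \<bullet> b) = (\<Prod>i\<in>UNIV. (u - l) $ Abs_ordered_copy i)"
    by (simp add: prod_Basis_cart inner_axis unlabel_def)
  also have "\<dots> = (\<Prod>i\<in>UNIV. (u - l) $ i)"
    by (rule prod.reindex_bij_witness[of _ Rep_ordered_copy Abs_ordered_copy]) auto
  also have "\<dots> = (\<Prod>b\<in>Basis. (u - l) \<bullet> b)"
    by (simp add: prod_Basis_cart inner_axis)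
  finally show "emeasure (distr lborel borel relabel) (box l u) = (\<Prod>b\<in>Basis. (u - l) \<bullet> b)" .
qed simp

text \<open>
  Conjugation with the relabelling reduces the estimate to well-ordered index types.  The image is
  assumed open so that its volume can be compared on Borel sets.
\<close>
lemma measure_perturbed_identity_image:
  fixes Y :: "real^'d::finite \<Rightarrow> real^'d" and S :: "(real^'d) set"
  assumes S: "open S" "bounded S" and open_image: "open ((\<lambda>x. x + h *\<^sub>R Y x) ` S)"
    and D: "\<And>x. (Y has_derivative D x) (at x)"
    and K: "\<And>x i j. \<bar>D x (axis j 1) $ i\<bar> \<le> K"
    and cont: "continuous_on UNIV (\<lambda>x. \<Sum>i\<in>UNIV. D x (axis i 1) $ i)"
    and h: "h \<ge> 0" "h * K * CARD('d) \<le> 1"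
  shows "measure lebesgue ((\<lambda>x. x + h *\<^sub>R Y x) ` S) \<le>
    (LINT x|lborel. indicator S x * (1 + h * (\<Sum>i\<in>UNIV. D x (axis i 1) $ i) + jacobian_constant CARD('d) K * h\<^sup>2))"
proof -
  let ?R = "relabel :: real^'d \<Rightarrow> _" and ?E = "\<lambda>x. x + h *\<^sub>R Y x"
  define Y' where "Y' = (\<lambda>y. relabel (Y (unlabel y)))"
  define D' where "D' = (\<lambda>y v. relabel (D (unlabel y) (unlabel v)))"
  have bl: "bounded_linear ?R" "bounded_linear (unlabel :: _ \<Rightarrow> real^'d)"
    using linear_relabel linear_unlabel by (simp_all add: linear_linear)
  have card: "CARD('d ordered_copy) = CARD('d)"
    using bij_Rep_ordered_copy by (rule bij_betw_same_card)
  then have C: "jacobian_constant CARD('d ordered_copy) K = jacobian_constant CARD('d) K"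
    by (simp add: jacobian_constant_def)
  have ax: "unlabel (axis i 1) = axis (Rep_ordered_copy i) (1::real)" for i
    by (auto simp: unlabel_def axis_def vec_eq_iff Abs_ordered_copy_inverse)
  have D'ax: "D' y (axis j 1) $ i = D (unlabel y) (axis (Rep_ordered_copy j) 1) $ Rep_ordered_copy i" for y i j
    by (simp add: D'_def ax relabel_def)
  have tr: "(\<Sum>i\<in>UNIV. D' y (axis i 1) $ i) = (\<Sum>i\<in>UNIV. D (unlabel y) (axis i 1) $ i)" for y
    unfolding D'ax by (rule sum.reindex_bij_betw[OF bij_Rep_ordered_copy])
  have img: "?R ` X = unlabel -` X" for X :: "(real^'d) set"
    by (auto simp: image_iff) (metis relabel_unlabel(1))
  have opn: "open (?R ` X)" if "open X" for X :: "(real^'d) set"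
    unfolding img using that by (intro open_vimage continuous_intros)
  have E': "(\<lambda>y. y + h *\<^sub>R Y' y) ` ?R ` X = ?R ` ?E ` X" for X
    by (auto simp: Y'_def image_image linear_add[OF linear_relabel] linear_scale[OF linear_relabel] intro!: image_cong)
  have meas: "measure lebesgue (?R ` X) = measure lebesgue X" if "open X" for X :: "(real^'d) set"
  proof -
    have "measure lborel (?R ` X) = measure (distr lborel borel ?R) (?R ` X)"
      by (simp add: distr_lborel_relabel)
    also have "\<dots> = measure lborel (?R -` ?R ` X)"
      using opn[OF that] by (simp add: measure_distr)
    also have "?R -` ?R ` X = X" by (auto simp: img)
    finally show ?thesis using that opn by simp
  qed
  have "measure lebesgue ((\<lambda>y. y + h *\<^sub>R Y' y) ` (?R ` S)) \<le>
    (LINT y|lborel. indicator (?R ` S) y * (1 + h * (\<Sum>i\<in>UNIV. D' y (axis i 1) $ i) + jacobian_constant CARD('d ordered_copy) K * h\<^sup>2))"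
  proof (rule measure_perturbed_identity_image_ordered)
    show "(Y' has_derivative D' y) (at y)" for y
      unfolding Y'_def D'_def
      using bounded_linear.has_derivative[OF bl(1) has_derivative_compose[OF bounded_linear_imp_has_derivative[OF bl(2)] D]] .
    show "\<bar>D' x (axis j 1) $ i\<bar> \<le> K" for x i j unfolding D'ax by (rule K)
    show "continuous_on UNIV (\<lambda>x. \<Sum>i\<in>UNIV. D' x (axis i 1) $ i)"
      unfolding tr by (rule continuous_on_compose2[OF cont]) (auto intro: continuous_intros)
    show "bounded (?R ` S)" by (rule bounded_linear_image[OF S(2) bl(1)])
  qed (use S opn h card in auto)
  also have "\<dots> = (LINT y|distr lborel borel ?R. indicator (?R ` S) y * (1 + h * (\<Sum>i\<in>UNIV. D (unlabel y) (axis i 1) $ i) + jacobian_constant CARD('d) K * h\<^sup>2))"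
    by (simp add: distr_lborel_relabel tr C)
  also have "\<dots> = (LINT x|lborel. indicator (?R ` S) (relabel x) * (1 + h * (\<Sum>i\<in>UNIV. D (unlabel (?R x)) (axis i 1) $ i) + jacobian_constant CARD('d) K * h\<^sup>2))"
  proof (rule integral_distr)
    have [measurable]: "(\<lambda>y. \<Sum>i\<in>UNIV. D (unlabel y) (axis i 1) $ i) \<in> borel_measurable borel"
      by (intro borel_measurable_continuous_onI continuous_on_compose2[OF cont]) (auto intro: continuous_intros)
    have [measurable]: "?R ` S \<in> sets borel" using opn S by simp
    show "(\<lambda>y. indicator (?R ` S) y * (1 + h * (\<Sum>i\<in>UNIV. D (unlabel y) (axis i 1) $ i) + jacobian_constant CARD('d) K * h\<^sup>2)) \<in> borel_measurable borel"
      by measurable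
  qed simp
  also have "\<dots> = (LINT x|lborel. indicator S x * (1 + h * (\<Sum>i\<in>UNIV. D x (axis i 1) $ i) + jacobian_constant CARD('d) K * h\<^sup>2))"
    by (intro Bochner_Integration.integral_cong) (auto simp: indicator_def img)
  finally show ?thesis unfolding E' meas[OF open_image] .
qed

section \<open>Short-time flows of Lipschitz fields\<close>

text \<open>
  The curve is continuous on the whole line although only its restriction to \<open>{0..h}\<close> solves the
  equation; controls built from it are then Borel functions without any restriction of the domain.
\<close>
definition solves_ode :: "('a::euclidean_space \<Rightarrow> 'a) \<Rightarrow> real \<Rightarrow> (real \<Rightarrow> 'a) \<Rightarrow> bool" where
  "solves_ode X h p \<longleftrightarrow> continuous_on UNIV p \<and>
     (\<forall>t\<in>{0..h}. (p has_vector_derivative X (p t)) (at t within {0..h}))"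

text \<open>
  Picard iteration: for \<open>h * L \<le> 1 / 2\<close> the integral operator is a contraction with factor one half on
  the bounded continuous curves.
\<close>
lemma ode_solution_exists:
  fixes X :: "'a::euclidean_space \<Rightarrow> 'a"
  assumes lip: "L-lipschitz_on UNIV X" and h: "h \<ge> 0" "h * L \<le> 1 / 2"
  obtains p where "solves_ode X h p" "p 0 = z"
proof -
  \<comment> \<open>Clamping the time to \<open>{0..h}\<close> makes the operator act on curves that are defined on the whole line.\<close>
  define P where "P q t = z + integral {0..max 0 (min h t)} (\<lambda>s. X (q s))"
    for q :: "real \<Rightarrow>\<^sub>C 'a" and t
  have contX: "continuous_on T X" for T
    using lipschitz_on_continuous_on[OF lip] continuous_on_subset by blast
  have contXq: "continuous_on T (\<lambda>s. X (apply_bcontfun q s))" for T q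
    by (intro continuous_on_compose2[OF contX[of UNIV]]) auto
  have clamp: "max 0 (min h t) \<in> {0..h}" for t using h by auto
  have Pcont: "P q \<in> bcontfun" for q
  proof -
    have c: "continuous_on {0..h} (\<lambda>t. z + integral {0..t} (\<lambda>s. X (q s)))"
      by (intro continuous_intros indefinite_integral_continuous_1 integrable_continuous_real contXq)
    have "continuous_on UNIV (P q)"
      unfolding P_def by (rule continuous_on_compose2[OF c, where f = "\<lambda>t. max 0 (min h t)"])
        (use clamp in \<open>auto intro!: continuous_intros\<close>)
    moreover have "range (P q) \<subseteq> (\<lambda>t. z + integral {0..t} (\<lambda>s. X (q s))) ` {0..h}"
      using clamp by (auto simp: P_def)
    then have "bounded (range (P q))"
      using compact_continuous_image[OF c] compact_imp_bounded bounded_subset by blast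
    ultimately show ?thesis by (simp add: bcontfun_def)
  qed
  define T where "T q = Bcontfun (P q)" for q
  have T: "apply_bcontfun (T q) = P q" for q
    by (simp add: T_def Bcontfun_inverse Pcont)
  have "dist (T q) (T r) \<le> 1 / 2 * dist q r" for q r
  proof (rule dist_bound)
    fix t
    let ?t = "max 0 (min h t)"
    have "dist (P q t) (P r t) = norm (integral {0..?t} (\<lambda>s. X (q s) - X (r s)))"
      unfolding P_def by (subst Henstock_Kurzweil_Integration.integral_diff)
        (auto intro!: integrable_continuous_real contXq simp: dist_norm)
    also have "\<dots> \<le> (L * dist q r) * (?t - 0)"
    proof (rule integral_bound)
      fix s
      have "norm (X (q s) - X (r s)) \<le> L * dist (q s) (r s)"
        using lipschitz_onD[OF lip, of "q s" "r s"] by (simp add: dist_norm)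
      also have "\<dots> \<le> L * dist q r"
        using lipschitz_on_nonneg[OF lip] by (intro mult_left_mono dist_bounded)
      finally show "norm (X (q s) - X (r s)) \<le> L * dist q r" .
    qed (auto intro!: continuous_intros contXq)
    also have "\<dots> \<le> (L * dist q r) * h"
      using clamp[of t] lipschitz_on_nonneg[OF lip] by (intro mult_left_mono) auto
    also have "\<dots> = (h * L) * dist q r" by simp
    also have "\<dots> \<le> 1 / 2 * dist q r" using h by (intro mult_right_mono) auto
    finally show "dist (T q t) (T r t) \<le> 1 / 2 * dist q r" by (simp add: T)
  qed
  then obtain p where p: "T p = p"
    using banach_fix_type[of "1/2" T] by auto
  have p_eq: "apply_bcontfun p t = z + integral {0..max 0 (min h t)} (\<lambda>s. X (p s))" for t
    unfolding P_def[of p t, symmetric] by (metis T p)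
  show ?thesis
  proof
    show "apply_bcontfun p 0 = z" using h by (subst p_eq) simp
    have "(p has_vector_derivative X (p t)) (at t within {0..h})" if t: "t \<in> {0..h}" for t
    proof (rule has_vector_derivative_transform[OF t])
      show "((\<lambda>t. z + integral {0..t} (\<lambda>s. X (p s))) has_vector_derivative X (p t)) (at t within {0..h})"
        using integral_has_vector_derivative[OF contXq t] by (auto intro!: derivative_eq_intros)
      show "apply_bcontfun p t = z + integral {0..t} (\<lambda>s. X (p s))" if "t \<in> {0..h}" for t
      proof -
        have "max 0 (min h t) = t" using that by auto
        then show ?thesis using p_eq[of t] by simp
      qed
    qed
    then show "solves_ode X h p" by (auto simp: solves_ode_def)
  qed
qed

text \<open>
  On so short an interval no exponential estimate is needed: the distance between the curves changes
  by at most \<open>h * L \<le> 1 / 2\<close> times its own maximum.  The reference time \<open>s\<close> is arbitrary, so the bound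
  gives uniqueness and injectivity of the flow map as well as Lipschitz dependence on the start.
\<close>
lemma ode_solutions_stable:
  fixes X :: "'a::euclidean_space \<Rightarrow> 'a"
  assumes lip: "L-lipschitz_on UNIV X" and h: "h * L \<le> 1 / 2"
    and p: "solves_ode X h p" and q: "solves_ode X h q" and s: "s \<in> {0..h}" and t: "t \<in> {0..h}"
  shows "dist (p t) (q t) \<le> 2 * dist (p s) (q s)"
proof -
  have "continuous_on {0..h} (\<lambda>t. dist (p t) (q t))"
    using p q by (auto simp: solves_ode_def intro!: continuous_intros intro: continuous_on_subset)
  then obtain m where m: "m \<in> {0..h}" "\<And>t. t \<in> {0..h} \<Longrightarrow> dist (p t) (q t) \<le> dist (p m) (q m)"
    using continuous_attains_sup[of "{0..h}" "\<lambda>t. dist (p t) (q t)"] s by auto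
  let ?M = "dist (p m) (q m)"
  have L: "L \<ge> 0" using lip by (rule lipschitz_on_nonneg)
  have "norm ((p m - q m) - (p s - q s)) \<le> (L * ?M) * norm (m - s)"
  proof (rule differentiable_bound[of "{0..h}"])
    fix t assume t: "t \<in> {0..h}"
    show "((\<lambda>t. p t - q t) has_derivative (\<lambda>r. r *\<^sub>R (X (p t) - X (q t)))) (at t within {0..h})"
      using p q t unfolding solves_ode_def has_vector_derivative_def[symmetric]
      by (auto intro!: derivative_intros)
    have "norm (X (p t) - X (q t)) \<le> L * ?M"
      using lipschitz_onD[OF lip, of "p t" "q t"] mult_left_mono[OF m(2)[OF t] L] by (simp add: dist_norm)
    then show "onorm (\<lambda>r. r *\<^sub>R (X (p t) - X (q t))) \<le> L * ?M"
      by (intro onorm_bound) (auto simp: mult.commute intro!: mult_left_mono mult_nonneg_nonneg L)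
  qed (use m s in auto)
  also have "\<dots> \<le> (L * ?M) * h"
    using L m s by (intro mult_left_mono) (auto simp: abs_le_iff)
  also have "\<dots> \<le> 1 / 2 * ?M" using mult_right_mono[OF h, of ?M] by (simp add: mult_ac)
  finally have "norm ((p m - q m) - (p s - q s)) \<le> ?M / 2" by simp
  moreover have "norm (p m - q m) \<le> norm ((p m - q m) - (p s - q s)) + norm (p s - q s)"
    using norm_triangle_ineq[of "(p m - q m) - (p s - q s)" "p s - q s"] by simp
  ultimately have "?M \<le> 2 * dist (p s) (q s)" by (simp add: dist_norm)
  with m(2)[OF t] show ?thesis by simp
qed

section \<open>The divergence over a flow-invariant open set\<close>

text \<open>
  Along a solution \<open>p\<close> of \<open>p' = - Y p\<close> the curve \<open>t \<mapsto> p t + t Y (p t)\<close> has derivative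
  \<open>- t Z (p t)\<close> with \<open>Z x = D x (Y x)\<close>: the first order terms cancel.  Comparing two solutions and
  integrating the factor \<open>t\<close> yields the square of \<open>h\<close>.
\<close>
lemma euler_step_of_backward_flow_close:
  fixes Y :: "'a::euclidean_space \<Rightarrow> 'a"
  assumes D: "\<And>x. (Y has_derivative D x) (at x)"
    and lipY: "L-lipschitz_on UNIV Y" and lipZ: "M-lipschitz_on UNIV (\<lambda>x. D x (Y x))"
    and h: "h \<ge> 0" "h * L \<le> 1 / 2"
    and p: "solves_ode (\<lambda>x. - Y x) h p" and q: "solves_ode (\<lambda>x. - Y x) h q"
  shows "norm ((p h + h *\<^sub>R Y (p h)) - (q h + h *\<^sub>R Y (q h)) - (p 0 - q 0)) \<le> (2 * M) * h\<^sup>2 * norm (p 0 - q 0)"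
proof -
  have lip': "L-lipschitz_on UNIV (\<lambda>x. - Y x)"
    using lipY by (simp add: lipschitz_on_def dist_minus)
  have M: "M \<ge> 0" using lipZ by (rule lipschitz_on_nonneg)
  let ?Z = "\<lambda>x. D x (Y x)"
  let ?F = "\<lambda>t. (p t + t *\<^sub>R Y (p t)) - (q t + t *\<^sub>R Y (q t))"
  have der: "((\<lambda>t. r t + t *\<^sub>R Y (r t)) has_vector_derivative - (t *\<^sub>R ?Z (r t))) (at t within {0..h})"
    if r: "solves_ode (\<lambda>x. - Y x) h r" and t: "t \<in> {0..h}" for r t
  proof -
    have r': "(r has_vector_derivative - Y (r t)) (at t within {0..h})"
      using r t by (simp add: solves_ode_def)
    have "((\<lambda>t. Y (r t)) has_vector_derivative D (r t) (- Y (r t))) (at t within {0..h})"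
      using has_derivative_compose[OF r'[unfolded has_vector_derivative_def] D]
      by (simp add: has_vector_derivative_def linear_scale[OF has_derivative_linear[OF D]] linear_neg[OF has_derivative_linear[OF D]])
    from has_vector_derivative_add[OF r' has_vector_derivative_scaleR[OF DERIV_ident this]]
    show ?thesis by (simp add: linear_neg[OF has_derivative_linear[OF D]])
  qed
  have "norm (?F h - ?F 0) \<le> (h * (M * (2 * norm (p 0 - q 0)))) * norm (h - 0)"
  proof (rule differentiable_bound[of "{0..h}"])
    fix t assume t: "t \<in> {0..h}"
    let ?d = "- (t *\<^sub>R ?Z (p t)) - - (t *\<^sub>R ?Z (q t))"
    show "(?F has_derivative (\<lambda>r. r *\<^sub>R ?d)) (at t within {0..h})"
      unfolding has_vector_derivative_def[symmetric]
      by (intro has_vector_derivative_diff der p q t)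
    have "norm ?d = t * norm (?Z (p t) - ?Z (q t))"
      using t by (simp add: scaleR_diff_right[symmetric] norm_minus_commute)
    also have "\<dots> \<le> h * (M * (2 * norm (p 0 - q 0)))"
    proof (intro mult_mono)
      have "norm (?Z (p t) - ?Z (q t)) \<le> M * dist (p t) (q t)"
        using lipschitz_onD[OF lipZ, of "p t" "q t"] by (simp add: dist_norm)
      also have "\<dots> \<le> M * (2 * dist (p 0) (q 0))"
        using ode_solutions_stable[OF lip' h(2) p q, of 0 t] t M by (intro mult_left_mono) auto
      finally show "norm (?Z (p t) - ?Z (q t)) \<le> M * (2 * norm (p 0 - q 0))" by (simp add: dist_norm)
    qed (use t in auto)
    finally show "onorm (\<lambda>r. r *\<^sub>R ?d) \<le> h * (M * (2 * norm (p 0 - q 0)))"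
      using M h by (intro onorm_bound) (auto simp: mult.commute intro!: mult_left_mono)
  qed (use h in auto)
  then show ?thesis using h by (simp add: power2_eq_square mult_ac)
qed

text \<open>
  The backward flow maps \<open>A\<close> into itself, so the forward motion covers \<open>A\<close> and the volume must not
  shrink to first order.
\<close>
lemma divergence_integral_nonneg:
  fixes Y :: "real^'d::finite \<Rightarrow> real^'d" and A :: "(real^'d) set"
  assumes A: "open A" "bounded A"
    and D: "\<And>x. (Y has_derivative D x) (at x)"
    and lipY: "L-lipschitz_on UNIV Y" and lipZ: "M-lipschitz_on UNIV (\<lambda>x. D x (Y x))"
    and K: "\<And>x i j. \<bar>D x (axis j 1) $ i\<bar> \<le> K"
    and cont: "continuous_on UNIV (\<lambda>x. \<Sum>i\<in>UNIV. D x (axis i 1) $ i)"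
    and inv: "\<And>h p. \<lbrakk>0 < h; h * L \<le> 1 / 2; solves_ode (\<lambda>x. - Y x) h p; p 0 \<in> A\<rbrakk> \<Longrightarrow> p h \<in> A"
  shows "0 \<le> (LINT x|lborel. indicator A x * (\<Sum>i\<in>UNIV. D x (axis i 1) $ i))"
proof -
  let ?n = "CARD('d)" and ?div = "\<lambda>x. \<Sum>i\<in>UNIV. D x (axis i 1) $ i"
  define I where "I = (LINT x|lborel. indicator A x * ?div x)"
  define C where "C = jacobian_constant ?n K"
  define m where "m = measure lebesgue A"
  have finA: "emeasure lborel A < \<infinity>" using A(2) by (rule emeasure_bounded_finite)
  have L: "L \<ge> 0" and M: "M \<ge> 0" using lipY lipZ by (auto dest: lipschitz_on_nonneg)
  have K0: "K \<ge> 0" using K[of undefined undefined undefined] by linarith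
  have C0: "C \<ge> 0" by (simp add: C_def jacobian_constant_def)
  have lip': "L-lipschitz_on UNIV (\<lambda>x. - Y x)"
    using lipY by (simp add: lipschitz_on_def dist_minus)
  have contY: "continuous_on UNIV Y" by (rule lipschitz_on_continuous_on[OF lipY])
  have "compact (?div ` closure A)"
    using A by (intro compact_continuous_image continuous_on_subset[OF cont]) auto
  then obtain B where "\<forall>y\<in>?div ` closure A. norm y \<le> B"
    by (meson bounded_iff compact_imp_bounded)
  then have B: "norm (?div x) \<le> B" if "x \<in> A" for x
    using closure_subset[of A] that by auto
  have int_div: "integrable lborel (\<lambda>x. indicator A x * ?div x)"
    using integrableI_bounded_set_indicator[where A = A and f = ?div and M = lborel and B = B] A B finA cont
    by (simp add: borel_measurable_continuous_onI)
  have int_A: "integrable lborel (\<lambda>x. indicator A x :: real)"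
    using A finA by simp
  \<comment> \<open>The volume comparison for one step size \<open>h\<close>, already divided by \<open>h\<close>; the claim follows as \<open>h\<close>
      tends to zero from the right.\<close>
  have key: "- (?n * (2 * M) + C) * m * h \<le> I"
    if h: "0 < h" "h * L \<le> 1 / 2" "h * K * ?n \<le> 1" "2 * M * h\<^sup>2 \<le> 1 / 2" for h
  proof -
    let ?c = "2 * M * h\<^sup>2" and ?E = "\<lambda>x. x + h *\<^sub>R Y x"
    have "\<exists>p. solves_ode (\<lambda>x. - Y x) h p \<and> p 0 = z" for z
      using ode_solution_exists[OF lip', of h z] h by (metis less_imp_le)
    then obtain p where p: "\<And>z. solves_ode (\<lambda>x. - Y x) h (p z)" "\<And>z. p z 0 = z" by metis
    define k where "k z = ?E (p z h)" for z
    have close: "norm (k z - k z' - (z - z')) \<le> ?c * norm (z - z')" for z z'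
      using euler_step_of_backward_flow_close[OF D lipY lipZ _ h(2) p(1)[of z] p(1)[of z']] h
      by (simp add: k_def p(2))
    \<comment> \<open>As \<open>k\<close> is close to the identity, it is injective and its inverse is almost non-expanding.\<close>
    have expand: "(1 - ?c) * norm (z - z') \<le> norm (k z - k z')" for z z'
      using close[of z z'] norm_triangle_ineq2[of "z - z'" "k z - k z'"]
      by (simp add: norm_minus_commute algebra_simps)
    have c: "0 \<le> ?c" "?c \<le> 1 / 2" using M h by auto
    have inj: "inj_on k A"
    proof (rule inj_onI)
      fix z z' assume "k z = k z'"
      then have "(1 - ?c) * norm (z - z') \<le> 0" using expand[of z z'] by simp
      then show "z = z'" using c by (simp add: mult_le_0_iff)
    qed
    have "(1 + ?c)-lipschitz_on UNIV k"
    proof (rule lipschitz_onI)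
      show "dist (k z) (k z') \<le> (1 + ?c) * dist z z'" for z z'
        using close[of z z'] norm_triangle_ineq2[of "k z - k z'" "z - z'"]
        by (simp add: dist_norm algebra_simps)
    qed (use c in auto)
    then have "continuous_on A k"
      by (rule continuous_on_subset[OF lipschitz_on_continuous_on]) simp
    then have open_k: "open (k ` A)" by (rule invariance_of_domain[OF _ A(1) inj])
    define j where "j = inv_into A k"
    have jk: "j (k z) = z" if "z \<in> A" for z using inj that by (simp add: j_def)
    have "(1 / (1 - ?c))-lipschitz_on (k ` A) j"
    proof (rule lipschitz_onI)
      fix x y assume "x \<in> k ` A" "y \<in> k ` A"
      then obtain z z' where "z \<in> A" "z' \<in> A" "x = k z" "y = k z'" by auto
      then show "dist (j x) (j y) \<le> 1 / (1 - ?c) * dist x y"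
        using expand[of z z'] c by (simp add: jk dist_norm field_simps)
    qed (use c in auto)
    moreover have jA: "j ` k ` A = A" using jk by force
    ultimately have "emeasure lebesgue A \<le> ennreal ((1 / (1 - ?c)) ^ ?n) * emeasure lebesgue (k ` A)"
      using emeasure_Lipschitz_image_le[OF open_k, of "1 / (1 - ?c)" j] c A by simp
    moreover have sub: "k ` A \<subseteq> ?E ` A"
      using inv[OF h(1,2) p(1)] p(2) by (auto simp: k_def)
    moreover have open_E: "open (?E ` A)"
    proof (rule invariance_of_domain)
      show "continuous_on A ?E"
        by (intro continuous_intros continuous_on_subset[OF contY]) auto
      show "inj_on ?E A"
      proof (rule inj_onI)
        fix x y assume "?E x = ?E y"
        then have "x - y = h *\<^sub>R (Y y - Y x)" by (simp add: algebra_simps)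
        then have "norm (x - y) = h * norm (Y y - Y x)" using h by (metis abs_of_pos norm_scaleR)
        also have "\<dots> \<le> h * (L * norm (x - y))"
          using lipschitz_onD[OF lipY, of y x] h by (intro mult_left_mono) (auto simp: dist_norm norm_minus_commute)
        also have "\<dots> \<le> 1 / 2 * norm (x - y)"
          using mult_right_mono[OF h(2), of "norm (x - y)"] by simp
        finally show "x = y" by simp
      qed
    qed (rule A)
    moreover have "bounded (?E ` A)"
    proof -
      have "compact (?E ` closure A)"
        using A by (intro compact_continuous_image continuous_intros continuous_on_subset[OF contY]) auto
      then show ?thesis using bounded_subset[OF compact_imp_bounded] closure_subset[of A] by (metis image_mono)
    qed
    ultimately have "m \<le> (1 / (1 - ?c)) ^ ?n * measure lebesgue (?E ` A)"
    proof -
      have fin: "?E ` A \<in> lmeasurable" "k ` A \<in> lmeasurable" "A \<in> lmeasurable"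
        using \<open>bounded (?E ` A)\<close> open_E open_k A bounded_subset[OF \<open>bounded (?E ` A)\<close> sub]
        by (auto intro!: bounded_set_imp_lmeasurable)
      have "ennreal m = emeasure lebesgue A" using fin by (simp add: m_def emeasure_eq_measure2)
      also have "\<dots> \<le> ennreal ((1 / (1 - ?c)) ^ ?n) * emeasure lebesgue (k ` A)" by fact
      also have "emeasure lebesgue (k ` A) = ennreal (measure lebesgue (k ` A))"
        using fin by (simp add: emeasure_eq_measure2)
      finally have "m \<le> (1 / (1 - ?c)) ^ ?n * measure lebesgue (k ` A)"
        using c by (simp add: ennreal_mult[symmetric])
      also have "\<dots> \<le> (1 / (1 - ?c)) ^ ?n * measure lebesgue (?E ` A)"
        using c fin by (intro mult_left_mono measure_mono_fmeasurable sub) auto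
      finally show ?thesis .
    qed
    then have "(1 - ?c) ^ ?n * m \<le> measure lebesgue (?E ` A)"
      using c by (simp add: field_simps)
    also have "measure lebesgue (?E ` A) \<le> (LINT x|lborel. indicator A x * (1 + h * ?div x + C * h\<^sup>2))"
      unfolding C_def using h by (intro measure_perturbed_identity_image A D K cont open_E) auto
    also have "\<dots> = (LINT x|lborel. (1 + C * h\<^sup>2) * indicator A x + h * (indicator A x * ?div x))"
      by (intro Bochner_Integration.integral_cong) (auto simp: algebra_simps)
    also have "\<dots> = (1 + C * h\<^sup>2) * m + h * I"
      using int_A int_div A by (simp add: I_def m_def)
    finally have "(1 - ?c) ^ ?n * m \<le> (1 + C * h\<^sup>2) * m + h * I" .
    moreover have "(1 - ?n * ?c) * m \<le> (1 - ?c) ^ ?n * m"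
      using Bernoulli_inequality[of "- ?c" ?n] c by (intro mult_right_mono) (auto simp: m_def)
    ultimately have "(1 - ?n * ?c) * m \<le> (1 + C * h\<^sup>2) * m + h * I" by linarith
    then have "h * (- (?n * (2 * M) + C) * m * h) \<le> h * I"
      by (simp add: algebra_simps power2_eq_square)
    then show ?thesis using h by simp
  qed
  have "\<forall>\<^sub>F h in at_right 0. - (?n * (2 * M) + C) * m * h \<le> I"
  proof -
    have "((\<lambda>h. h * L) \<longlongrightarrow> 0 * L) (at_right 0)" "((\<lambda>h. h * K * ?n) \<longlongrightarrow> 0 * K * ?n) (at_right 0)"
      "((\<lambda>h. 2 * M * h\<^sup>2) \<longlongrightarrow> 2 * M * 0\<^sup>2) (at_right 0)"
      by (intro tendsto_intros)+
    from this[THEN order_tendstoD(2), of "1 / 2"] this(2)[THEN order_tendstoD(2), of 1]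
    have "\<forall>\<^sub>F h in at_right 0. h * L < 1 / 2" "\<forall>\<^sub>F h in at_right 0. h * K * ?n < 1"
      "\<forall>\<^sub>F h in at_right 0. 2 * M * h\<^sup>2 < 1 / 2" by simp_all
    then show ?thesis using eventually_at_right_less[of 0]
      by eventually_elim (rule key, auto)
  qed
  moreover have "((\<lambda>h. - (?n * (2 * M) + C) * m * h) \<longlongrightarrow> - (?n * (2 * M) + C) * m * 0) (at_right 0)"
    by (intro tendsto_intros)
  ultimately show ?thesis
    using tendsto_upperbound[of _ _ "at_right (0::real)" I] by (simp add: I_def)
qed

text \<open>Invariance in both time directions allows the sign of the field to be reversed.\<close>
lemma divergence_integral_zero:
  fixes Y :: "real^'d::finite \<Rightarrow> real^'d" and A :: "(real^'d) set"
  assumes A: "open A" "bounded A"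
    and D: "\<And>x. (Y has_derivative D x) (at x)"
    and lipY: "L-lipschitz_on UNIV Y" and lipZ: "M-lipschitz_on UNIV (\<lambda>x. D x (Y x))"
    and K: "\<And>x i j. \<bar>D x (axis j 1) $ i\<bar> \<le> K"
    and cont: "continuous_on UNIV (\<lambda>x. \<Sum>i\<in>UNIV. D x (axis i 1) $ i)"
    and inv: "\<And>s h p. \<lbrakk>\<bar>s\<bar> = 1; 0 < h; h * L \<le> 1 / 2; solves_ode (\<lambda>x. s *\<^sub>R Y x) h p; p 0 \<in> A\<rbrakk> \<Longrightarrow> p h \<in> A"
  shows "(LINT x|lborel. indicator A x * (\<Sum>i\<in>UNIV. D x (axis i 1) $ i)) = 0"
proof (rule antisym)
  show "0 \<le> (LINT x|lborel. indicator A x * (\<Sum>i\<in>UNIV. D x (axis i 1) $ i))"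
    by (rule divergence_integral_nonneg[OF A D lipY lipZ K cont]) (use inv[of "- 1"] in auto)
  have "0 \<le> (LINT x|lborel. indicator A x * (\<Sum>i\<in>UNIV. (- D x (axis i 1)) $ i))"
  proof (rule divergence_integral_nonneg[OF A, where Y = "\<lambda>x. - Y x" and L = L and M = M and K = K])
    show "((\<lambda>x. - Y x) has_derivative (\<lambda>v. - D x v)) (at x)" for x
      by (intro has_derivative_minus D)
    show "L-lipschitz_on UNIV (\<lambda>x. - Y x)"
      using lipY by (simp add: lipschitz_on_def dist_minus)
    show "M-lipschitz_on UNIV (\<lambda>x. - D x (- Y x))"
      using lipZ by (simp add: linear_neg[OF has_derivative_linear[OF D]])
    show "\<bar>(- D x (axis j 1)) $ i\<bar> \<le> K" for x i j using K[of x j i] by simp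
    show "continuous_on UNIV (\<lambda>x. \<Sum>i\<in>UNIV. (- D x (axis i 1)) $ i)"
      using continuous_on_minus[OF cont] by (simp add: sum_negf)
  qed (use inv[of 1] in auto)
  then show "(LINT x|lborel. indicator A x * (\<Sum>i\<in>UNIV. D x (axis i 1) $ i)) \<le> 0"
    by (simp add: sum_negf)
qed

section \<open>Calculus of continuously differentiable functions\<close>

text \<open>
  Functions that agree near a point have the same derivatives there, if any, so the choice operator in
  the definition picks the same value for both.
\<close>
lemma frechet_derivative_cong_open:
  assumes "open S" "x \<in> S" "\<And>y. y \<in> S \<Longrightarrow> f y = g y"
  shows "frechet_derivative f (at x) = frechet_derivative g (at x)"
proof -
  have "(f has_derivative D) (at x) \<longleftrightarrow> (g has_derivative D) (at x)" for D
    using assms has_derivative_transform_within_open[of f D x UNIV S g]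
      has_derivative_transform_within_open[of g D x UNIV S f] by auto
  then show ?thesis by (simp add: frechet_derivative_def)
qed

lemma partial_deriv_cong_open:
  "open S \<Longrightarrow> x \<in> S \<Longrightarrow> (\<And>y. y \<in> S \<Longrightarrow> f y = g y) \<Longrightarrow> partial_deriv j f x = partial_deriv j g x"
  unfolding partial_deriv_def by (subst frechet_derivative_cong_open[of S x f g]) auto

lemma partial_deriv_eqI: "(f has_derivative D) (at x) \<Longrightarrow> partial_deriv j f x = D (axis j 1)"
  by (simp add: partial_deriv_def frechet_derivative_at[symmetric])

lemma differentiable_cong_open:
  assumes "open S" "x \<in> S" "\<And>y. y \<in> S \<Longrightarrow> f y = g y"
  shows "f differentiable (at x) \<longleftrightarrow> g differentiable (at x)"
  using assms has_derivative_transform_within_open[of f _ x UNIV S g]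
      has_derivative_transform_within_open[of g _ x UNIV S f] by (auto simp: differentiable_def)

lemma Ck_on_cong:
  assumes "open S" "\<And>x. x \<in> S \<Longrightarrow> f x = g x"
  shows "Ck_on k S f \<longleftrightarrow> Ck_on k S g"
  using assms(2)
proof (induction k arbitrary: f g)
  case 0
  then show ?case by (simp cong: continuous_on_cong)
next
  case (Suc k)
  have "Ck_on k S (partial_deriv j f) \<longleftrightarrow> Ck_on k S (partial_deriv j g)" for j
    by (rule Suc.IH) (rule partial_deriv_cong_open[OF \<open>open S\<close> _ Suc.prems])
  moreover have "f differentiable (at x) \<longleftrightarrow> g differentiable (at x)" if "x \<in> S" for x
    by (rule differentiable_cong_open[OF \<open>open S\<close> that Suc.prems])
  ultimately show ?case by simp
qed

lemma Ck_on_SucD: "Ck_on (Suc k) S f \<Longrightarrow> Ck_on k S f"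
proof (induction k arbitrary: f)
  case 0
  then show ?case
    by (auto intro!: continuous_at_imp_continuous_on differentiable_imp_continuous_within)
next
  case (Suc k)
  show ?case unfolding Ck_on.simps(2)[of k]
    using Suc.prems Suc.IH Ck_on.simps(2)[of "Suc k" S f] by blast
qed

lemma Ck_on_Un:
  "open S \<Longrightarrow> open T \<Longrightarrow> Ck_on k S f \<Longrightarrow> Ck_on k T f \<Longrightarrow> Ck_on k (S \<union> T) f"
  by (induction k arbitrary: f) (auto intro: continuous_on_open_Un)

lemma Ck_on_zero: "Ck_on k S (\<lambda>x :: real^'d::finite. 0 :: 'b::real_normed_vector)"
proof (induction k)
  case (Suc k)
  have "partial_deriv j (\<lambda>x :: real^'d. 0 :: 'b) = (\<lambda>x. 0)" for j
    by (auto simp: partial_deriv_def)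
  then show ?case using Suc by simp
qed simp

lemma Ck_on_add:
  assumes "open S" "Ck_on k S f" "Ck_on k S g"
  shows "Ck_on k S (\<lambda>x. f x + g x)"
  using assms(2,3)
proof (induction k arbitrary: f g)
  case 0
  then show ?case by (auto intro: continuous_intros)
next
  case (Suc k)
  have "Ck_on k S (partial_deriv j (\<lambda>x. f x + g x))" for j
  proof (subst Ck_on_cong[OF \<open>open S\<close>])
    fix x assume "x \<in> S"
    then have "f differentiable (at x)" "g differentiable (at x)" using Suc.prems by auto
    then obtain f' g' where fg: "(f has_derivative f') (at x)" "(g has_derivative g') (at x)"
      unfolding differentiable_def by blast
    show "partial_deriv j (\<lambda>x. f x + g x) x = partial_deriv j f x + partial_deriv j g x"
      using fg[THEN partial_deriv_eqI] partial_deriv_eqI[OF has_derivative_add[OF fg]] by simp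
  next
    show "Ck_on k S (\<lambda>x. partial_deriv j f x + partial_deriv j g x)"
      using Suc.prems by (intro Suc.IH) auto
  qed
  then show ?case using Suc.prems by auto
qed

lemma Ck_on_scaleR:
  fixes f :: "real^'d::finite \<Rightarrow> real"
  assumes "open S" "Ck_on k S f" "Ck_on k S g"
  shows "Ck_on k S (\<lambda>x. f x *\<^sub>R g x)"
  using assms(2,3)
proof (induction k arbitrary: f g)
  case 0
  then show ?case by (auto intro: continuous_intros)
next
  case (Suc k)
  have "Ck_on k S (partial_deriv j (\<lambda>x. f x *\<^sub>R g x))" for j
  proof (subst Ck_on_cong[OF \<open>open S\<close>])
    fix x assume "x \<in> S"
    then have "f differentiable (at x)" "g differentiable (at x)" using Suc.prems by auto
    then obtain f' g' where fg: "(f has_derivative f') (at x)" "(g has_derivative g') (at x)"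
      unfolding differentiable_def by blast
    show "partial_deriv j (\<lambda>x. f x *\<^sub>R g x) x = f x *\<^sub>R partial_deriv j g x + partial_deriv j f x *\<^sub>R g x"
      using fg[THEN partial_deriv_eqI] partial_deriv_eqI[OF has_derivative_scaleR[OF fg]] by simp
  next
    show "Ck_on k S (\<lambda>x. f x *\<^sub>R partial_deriv j g x + partial_deriv j f x *\<^sub>R g x)"
      using Suc.prems by (intro Ck_on_add \<open>open S\<close> Suc.IH) (auto intro: Ck_on_SucD)
  qed
  then show ?case using Suc.prems by auto
qed

lemma Ck_on_component:
  assumes "open S" "Ck_on k S f"
  shows "Ck_on k S (\<lambda>x. f x $ i)"
  using assms(2)
proof (induction k arbitrary: f)
  case 0
  then show ?case by (auto intro: continuous_intros)
next
  case (Suc k)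
  have "Ck_on k S (partial_deriv j (\<lambda>x. f x $ i))" for j
  proof (subst Ck_on_cong[OF \<open>open S\<close>])
    fix x assume "x \<in> S"
    then have "f differentiable (at x)" using Suc.prems by auto
    then obtain f' where f: "(f has_derivative f') (at x)"
      unfolding differentiable_def by blast
    show "partial_deriv j (\<lambda>x. f x $ i) x = partial_deriv j f x $ i"
      using partial_deriv_eqI[OF f] partial_deriv_eqI[OF bounded_linear.has_derivative[OF bounded_linear_vec_nth f]]
      by simp
  next
    show "Ck_on k S (\<lambda>x. partial_deriv j f x $ i)"
      using Suc.prems by (intro Suc.IH) auto
  qed
  moreover have "(\<lambda>x. f x $ i) differentiable (at x)" if "x \<in> S" for x
  proof -
    have "f differentiable (at x)" using Suc.prems that by auto
    then show ?thesis
      unfolding differentiable_def using bounded_linear.has_derivative[OF bounded_linear_vec_nth] by blast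
  qed
  ultimately show ?case by auto
qed

lemma Ck_on_sum:
  assumes "open S" "finite J" "\<And>j. j \<in> J \<Longrightarrow> Ck_on k S (f j)"
  shows "Ck_on k S (\<lambda>x. \<Sum>j\<in>J. f j x)"
  using assms(2,3) by (induction J rule: finite_induct) (auto intro: Ck_on_zero Ck_on_add[OF \<open>open S\<close>])

lemma frechet_derivative_eq_sum_partial_deriv:
  assumes "f differentiable (at x)"
  shows "frechet_derivative f (at x) v = (\<Sum>j\<in>UNIV. v $ j *\<^sub>R partial_deriv j f x)"
proof -
  have lin: "linear (frechet_derivative f (at x))"
    using assms by (rule linear_frechet_derivative)
  have "frechet_derivative f (at x) v = frechet_derivative f (at x) (\<Sum>j\<in>UNIV. v $ j *\<^sub>R axis j 1)"
    using basis_expansion[of v] by (simp add: scalar_mult_eq_scaleR)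
  also have "\<dots> = (\<Sum>j\<in>UNIV. v $ j *\<^sub>R partial_deriv j f x)"
    by (simp add: linear_sum[OF lin] linear_scale[OF lin] partial_deriv_def)
  finally show ?thesis .
qed

lemma bounded_range_compact_support:
  assumes "compact K" "continuous_on UNIV f" "\<And>x. x \<notin> K \<Longrightarrow> f x = 0"
  obtains B where "B \<ge> 0" "\<And>x. norm (f x) \<le> B"
proof -
  have "bounded (f ` K)"
    using assms by (intro compact_imp_bounded compact_continuous_image) (auto intro: continuous_on_subset)
  then obtain B where "\<And>x. x \<in> K \<Longrightarrow> norm (f x) \<le> B" by (auto simp: bounded_iff)
  then have "norm (f x) \<le> max B 0" for x using assms(3)[of x] by (cases "x \<in> K") (auto simp: le_max_iff_disj)
  then show ?thesis using that[of "max B 0"] by auto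
qed

lemma partial_deriv_zero_outside_support:
  assumes "compact K" "\<And>x. x \<notin> K \<Longrightarrow> f x = 0" "x \<notin> K"
  shows "partial_deriv j f x = 0"
proof -
  have "partial_deriv j f x = partial_deriv j (\<lambda>x. 0) x"
    using assms by (intro partial_deriv_cong_open[of "- K"]) (auto simp: compact_imp_closed)
  then show ?thesis by (simp add: partial_deriv_def)
qed

lemma C1_compact_support_Lipschitz:
  fixes f :: "real^'d::finite \<Rightarrow> 'b::real_normed_vector"
  assumes f: "Ck_on 1 UNIV f" and K: "compact K" "\<And>x. x \<notin> K \<Longrightarrow> f x = 0"
  obtains L where "L-lipschitz_on UNIV f"
proof -
  have d: "f differentiable (at x)" for x using f by simp
  have "\<exists>B\<ge>0. \<forall>x. norm (partial_deriv j f x) \<le> B" for j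
    using bounded_range_compact_support[OF K(1), of "partial_deriv j f"] f
      partial_deriv_zero_outside_support[OF K] by auto metis
  then obtain B where B: "\<And>j. B j \<ge> 0" "\<And>j x. norm (partial_deriv j f x) \<le> B j" by metis
  have "(\<Sum>j\<in>UNIV. B j)-lipschitz_on UNIV f"
  proof (rule lipschitz_onI)
    fix x y
    have "norm (f x - f y) \<le> (\<Sum>j\<in>UNIV. B j) * norm (x - y)"
    proof (rule differentiable_bound[of UNIV])
      show "(f has_derivative frechet_derivative f (at x)) (at x)" for x
        using d frechet_derivative_works by blast
      show "onorm (frechet_derivative f (at x)) \<le> (\<Sum>j\<in>UNIV. B j)" for x
      proof (rule onorm_bound)
        fix v :: "real^'d"
        have "norm (frechet_derivative f (at x) v) \<le> (\<Sum>j\<in>UNIV. norm (v $ j *\<^sub>R partial_deriv j f x))"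
          unfolding frechet_derivative_eq_sum_partial_deriv[OF d] by (rule norm_sum)
        also have "\<dots> \<le> (\<Sum>j\<in>UNIV. B j * norm v)"
          using B component_le_norm_cart[of v] by (intro sum_mono) (auto simp: mult.commute[of "B _"] intro!: mult_mono)
        finally show "norm (frechet_derivative f (at x) v) \<le> (\<Sum>j\<in>UNIV. B j) * norm v"
          by (simp add: sum_distrib_right)
      qed (auto intro: sum_nonneg B)
    qed auto
    then show "dist (f x) (f y) \<le> (\<Sum>j\<in>UNIV. B j) * dist x y" by (simp add: dist_norm)
  qed (auto intro: sum_nonneg B)
  then show ?thesis by (rule that)
qed

text \<open>
  Outside \<open>\<Omega>\<close> the field \<open>g\<close> may be arbitrary, but there the product vanishes on the open complement of
  the support, which together with \<open>\<Omega>\<close> covers the space.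
\<close>
lemma test_function_times_field_C2:
  fixes g :: "real^'d::finite \<Rightarrow> real^'d"
  assumes "open \<Omega>" "Ck_on 2 \<Omega> g" "\<phi> \<in> test_functions \<Omega>"
  shows "Ck_on 2 UNIV (\<lambda>x. \<phi> x *\<^sub>R g x)"
proof -
  define K where "K = closure {x. \<phi> x \<noteq> 0}"
  have K: "K \<subseteq> \<Omega>" "closed K" "\<And>x. x \<notin> K \<Longrightarrow> \<phi> x = 0"
    using assms(3) closure_subset[of "{x. \<phi> x \<noteq> 0}"] by (auto simp: test_functions_def K_def)
  have mono: "Ck_on k UNIV \<phi> \<Longrightarrow> Ck_on k \<Omega> \<phi>" for k and \<phi> :: "real^'d \<Rightarrow> real"
    by (induction k arbitrary: \<phi>) (auto intro: continuous_on_subset)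
  have "Ck_on 2 \<Omega> \<phi>" using assms(3) by (intro mono) (auto simp: test_functions_def)
  then have "Ck_on 2 \<Omega> (\<lambda>x. \<phi> x *\<^sub>R g x)" using assms by (intro Ck_on_scaleR)
  moreover have "Ck_on 2 (- K) (\<lambda>x. \<phi> x *\<^sub>R g x)"
    by (subst Ck_on_cong[of _ _ "\<lambda>x. 0"]) (use K in \<open>auto intro: Ck_on_zero\<close>)
  ultimately have "Ck_on 2 (\<Omega> \<union> - K) (\<lambda>x. \<phi> x *\<^sub>R g x)"
    using assms(1) K by (intro Ck_on_Un) auto
  moreover have "\<Omega> \<union> - K = UNIV" using K by auto
  ultimately show ?thesis by simp
qed

text \<open>
  These are exactly the regularity hypotheses of the divergence estimate.  Two derivatives are used for
  the Lipschitz bound on \<open>\<lambda>x. D x (Y x)\<close>, whose first derivatives involve second derivatives of \<open>Y\<close>.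
\<close>
lemma C2_compact_support_field:
  fixes Y :: "real^'d::finite \<Rightarrow> real^'d"
  assumes C2: "Ck_on 2 UNIV Y" and K: "compact K" "\<And>x. x \<notin> K \<Longrightarrow> Y x = 0"
  defines "D \<equiv> \<lambda>x. frechet_derivative Y (at x)"
  obtains L M B where "\<And>x. (Y has_derivative D x) (at x)" "L-lipschitz_on UNIV Y"
    "M-lipschitz_on UNIV (\<lambda>x. D x (Y x))" "\<And>x i j. \<bar>D x (axis j 1) $ i\<bar> \<le> B"
    "continuous_on UNIV (\<lambda>x. \<Sum>i\<in>UNIV. D x (axis i 1) $ i)"
proof -
  have C1: "Ck_on 1 UNIV Y" using Ck_on_SucD[of 1 UNIV Y] C2 by (simp add: numeral_2_eq_2)
  have P1: "Ck_on 1 UNIV (partial_deriv j Y)" for j using C2 by (simp add: numeral_2_eq_2)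
  have d: "Y differentiable (at x)" for x using C1 by simp
  have cP: "continuous_on UNIV (partial_deriv j Y)" for j using C1 by simp
  obtain L where L: "L-lipschitz_on UNIV Y" by (rule C1_compact_support_Lipschitz[OF C1 K])
  have Dax: "D x (axis j 1) = partial_deriv j Y x" for x j by (simp add: D_def partial_deriv_def)
  let ?Z = "\<lambda>x. \<Sum>j\<in>UNIV. Y x $ j *\<^sub>R partial_deriv j Y x"
  have "Ck_on 1 UNIV ?Z"
    by (intro Ck_on_sum Ck_on_scaleR Ck_on_component C1 P1) auto
  then obtain M where "M-lipschitz_on UNIV ?Z"
    by (rule C1_compact_support_Lipschitz[OF _ K(1)]) (simp add: K(2))
  then have M: "M-lipschitz_on UNIV (\<lambda>x. D x (Y x))"
    unfolding D_def frechet_derivative_eq_sum_partial_deriv[OF d] .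
  have "\<exists>B\<ge>0. \<forall>x. norm (partial_deriv j Y x) \<le> B" for j
    by (rule bounded_range_compact_support[OF K(1) cP partial_deriv_zero_outside_support[OF K]]) blast+
  then obtain B where B: "\<And>j. B j \<ge> 0" "\<And>j x. norm (partial_deriv j Y x) \<le> B j" by metis
  have "\<bar>D x (axis j 1) $ i\<bar> \<le> (\<Sum>j\<in>UNIV. B j)" for x i j
  proof -
    have "\<bar>D x (axis j 1) $ i\<bar> \<le> B j"
      using order_trans[OF component_le_norm_cart B(2)] by (simp add: Dax)
    also have "B j \<le> (\<Sum>j\<in>UNIV. B j)" by (rule member_le_sum) (use B in auto)
    finally show ?thesis .
  qed
  moreover have "continuous_on UNIV (\<lambda>x. \<Sum>i\<in>UNIV. D x (axis i 1) $ i)"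
    unfolding Dax by (intro continuous_intros cP)
  moreover have "(Y has_derivative D x) (at x)" for x
    unfolding D_def using d frechet_derivative_works by blast
  ultimately show ?thesis using L M by (intro that)
qed

lemma field_adjoint_eq_divergence:
  fixes g :: "real^'d::finite \<Rightarrow> real^'d"
  assumes "\<And>x. ((\<lambda>x. \<phi> x *\<^sub>R g x) has_derivative D x) (at x)"
  shows "field_adjoint g \<phi> x = - (\<Sum>i\<in>UNIV. D x (axis i 1) $ i)"
proof -
  have "partial_deriv j (\<lambda>y. g y $ j * \<phi> y) x = D x (axis j 1) $ j" for j
    using partial_deriv_eqI[OF bounded_linear.has_derivative[OF bounded_linear_vec_nth assms[of x]]]
    by (simp add: mult.commute)
  then show ?thesis by (simp add: field_adjoint_def)
qed

section \<open>Steering with bounded controls\<close>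

text \<open>
  A more rigid notion than that of a trajectory: the control is a bounded Borel function and the
  equation holds outside finitely many times.  Such curves are easy to concatenate, and Lipschitz when
  the fields are continuous; the time horizon \<open>T\<close> is kept variable so that concatenation needs no rescaling.
\<close>
definition steering :: "(real^'d::finite) set \<Rightarrow> ('m::finite \<Rightarrow> real^'d \<Rightarrow> real^'d) \<Rightarrow> real \<Rightarrow>
    (real \<Rightarrow> real^'d) \<Rightarrow> bool" where
  "steering \<Omega> g T \<gamma> \<longleftrightarrow> 0 < T \<and> continuous_on {0..T} \<gamma> \<and> \<gamma> ` {0..T} \<subseteq> \<Omega> \<and>
     (\<exists>(u :: real \<Rightarrow> real^'m) N. u \<in> borel_measurable borel \<and> bounded (range u) \<and> finite N \<and>
        (\<forall>t\<in>{0<..<T} - N. (\<gamma> has_vector_derivative (\<Sum>i\<in>UNIV. u t $ i *\<^sub>R g i (\<gamma> t))) (at t)))"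

lemma steering_append:
  assumes "steering \<Omega> g T \<gamma>" "steering \<Omega> g S \<eta>" "\<gamma> T = \<eta> 0"
  shows "steering \<Omega> g (T + S) (\<lambda>t. if t \<le> T then \<gamma> t else \<eta> (t - T))" (is "steering _ _ _ ?\<zeta>")
proof -
  obtain u :: "real \<Rightarrow> real^'b" and N where u: "u \<in> borel_measurable borel" "bounded (range u)" "finite N"
    "\<And>t. t \<in> {0<..<T} - N \<Longrightarrow> (\<gamma> has_vector_derivative (\<Sum>i\<in>UNIV. u t $ i *\<^sub>R g i (\<gamma> t))) (at t)"
    using assms(1) unfolding steering_def by blast
  obtain v :: "real \<Rightarrow> real^'b" and M where v: "v \<in> borel_measurable borel" "bounded (range v)" "finite M"
    "\<And>t. t \<in> {0<..<S} - M \<Longrightarrow> (\<eta> has_vector_derivative (\<Sum>i\<in>UNIV. v t $ i *\<^sub>R g i (\<eta> t))) (at t)"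
    using assms(2) unfolding steering_def by blast
  have \<gamma>: "0 < T" "continuous_on {0..T} \<gamma>" "\<gamma> ` {0..T} \<subseteq> \<Omega>"
    and \<eta>: "0 < S" "continuous_on {0..S} \<eta>" "\<eta> ` {0..S} \<subseteq> \<Omega>"
    using assms by (auto simp: steering_def)
  \<comment> \<open>The curve may have a corner at the junction, so \<open>T\<close> joins the exceptional times.\<close>
  let ?w = "\<lambda>t. if t \<le> T then u t else v (t - T)" and ?N = "insert T (N \<union> (\<lambda>t. t + T) ` M)"
  have "continuous_on {0..T + S} ?\<zeta>"
  proof (rule continuous_on_cases_le[where h = "\<lambda>t. t" and a = T])
    show "continuous_on {t \<in> {0..T + S}. t \<le> T} \<gamma>"
      by (rule continuous_on_subset[OF \<gamma>(2)]) auto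
    show "continuous_on {t \<in> {0..T + S}. T \<le> t} (\<lambda>t. \<eta> (t - T))"
      by (rule continuous_on_compose2[OF \<eta>(2)]) (auto intro!: continuous_intros)
  qed (use assms(3) in \<open>auto intro!: continuous_intros\<close>)
  moreover have "?\<zeta> ` {0..T + S} \<subseteq> \<Omega>"
    using \<gamma>(3) \<eta>(3) by (auto simp: image_subset_iff)
  moreover have "?w \<in> borel_measurable borel"
  proof -
    have [measurable]: "u \<in> borel_measurable borel" "v \<in> borel_measurable borel" by fact+
    show ?thesis by measurable
  qed
  moreover have "bounded (range ?w)"
    by (rule bounded_subset[OF bounded_Un[THEN iffD2, OF conjI[OF u(2) v(2)]]]) auto
  moreover have "finite ?N" using u v by auto
  moreover have "(?\<zeta> has_vector_derivative (\<Sum>i\<in>UNIV. ?w t $ i *\<^sub>R g i (?\<zeta> t))) (at t)"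
    if t: "t \<in> {0<..<T + S} - ?N" for t
  proof (cases "t < T")
    case True
    have "(\<gamma> has_vector_derivative (\<Sum>i\<in>UNIV. u t $ i *\<^sub>R g i (\<gamma> t))) (at t)"
      using t True by (intro u) auto
    then have "(?\<zeta> has_vector_derivative (\<Sum>i\<in>UNIV. u t $ i *\<^sub>R g i (\<gamma> t))) (at t)"
      by (rule has_vector_derivative_transform_within_open[where S = "{..<T}"]) (use True in auto)
    then show ?thesis using True by simp
  next
    case False
    then have tT: "T < t" using t by auto
    have "t - T \<notin> M" using t by (auto simp: image_iff)
    then have "(\<eta> has_vector_derivative (\<Sum>i\<in>UNIV. v (t - T) $ i *\<^sub>R g i (\<eta> (t - T)))) (at (t - T))"
      using t tT by (intro v) auto
    moreover have "((\<lambda>t. t - T) has_vector_derivative 1) (at t)"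
      by (auto intro!: derivative_eq_intros)
    ultimately have "((\<lambda>t. \<eta> (t - T)) has_vector_derivative (\<Sum>i\<in>UNIV. v (t - T) $ i *\<^sub>R g i (\<eta> (t - T)))) (at t)"
      using vector_diff_chain_at[of "\<lambda>t. t - T" 1 t \<eta>] by (simp add: o_def)
    then have "(?\<zeta> has_vector_derivative (\<Sum>i\<in>UNIV. v (t - T) $ i *\<^sub>R g i (\<eta> (t - T)))) (at t)"
      by (rule has_vector_derivative_transform_within_open[where S = "{T<..}"]) (use tT in auto)
    then show ?thesis using tT by simp
  qed
  ultimately show ?thesis unfolding steering_def using \<gamma>(1) \<eta>(1) by (intro conjI exI[of _ ?w] exI[of _ ?N]) auto
qed

lemma Lipschitz_imp_abs_continuous_on:
  fixes f :: "real \<Rightarrow> 'b::real_normed_vector"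
  assumes "C \<ge> 0" "\<And>a b. a \<le> b \<Longrightarrow> {a..b} \<subseteq> S \<Longrightarrow> norm (f b - f a) \<le> C * (b - a)"
  shows "abs_continuous_on S f"
  unfolding abs_continuous_on_def
proof (intro allI impI exI conjI)
  fix e :: real assume e: "e > 0"
  show "e / (C + 1) > 0" using e assms by simp
  fix D :: "(real \<times> real) set"
  assume D: "finite D" "\<forall>(a, b)\<in>D. a \<le> b \<and> {a..b} \<subseteq> S" and sm: "(\<Sum>(a, b)\<in>D. b - a) < e / (C + 1)"
  have "(\<Sum>(a, b)\<in>D. norm (f b - f a)) \<le> (\<Sum>(a, b)\<in>D. C * (b - a))"
    using D(2) assms by (intro sum_mono) auto
  also have "\<dots> = C * (\<Sum>(a, b)\<in>D. b - a)" by (simp add: sum_distrib_left case_prod_beta)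
  also have "\<dots> \<le> C * (e / (C + 1))" using sm assms by (intro mult_left_mono) auto
  also have "\<dots> < e" using e assms by (simp add: field_simps)
  finally show "(\<Sum>(a, b)\<in>D. norm (f b - f a)) < e" .
qed

lemma bounded_in_L2_space:
  fixes f :: "'a::euclidean_space \<Rightarrow> 'b::euclidean_space"
  assumes "f \<in> borel_measurable (lebesgue_on S)" "\<And>x. x \<in> S \<Longrightarrow> norm (f x) \<le> B" "S \<in> lmeasurable"
  shows "f \<in> L2_space S"
proof -
  interpret finite_measure "lebesgue_on S"
    using assms(3) by (intro finite_measureI) (auto simp: emeasure_restrict_space fmeasurable_def)
  have [measurable]: "f \<in> borel_measurable (lebesgue_on S)" by fact
  have "integrable (lebesgue_on S) (\<lambda>x. (norm (f x))\<^sup>2)"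
  proof (rule integrable_const_bound[where B = "B\<^sup>2"])
    show "AE x in lebesgue_on S. norm ((norm (f x))\<^sup>2) \<le> B\<^sup>2"
      using assms(2) by (intro AE_I2) (auto intro!: power_mono)
  qed measurable
  then show ?thesis using assms by (simp add: L2_space_def)
qed

text \<open>
  Continuity of the fields along the compact curve turns the bounded control into a bounded velocity.
  The fundamental theorem of calculus with finitely many exceptions then gives a Lipschitz bound, hence
  absolute continuity.
\<close>
lemma steering_imp_trajectory:
  fixes \<Omega> :: "(real^'d::finite) set" and g :: "'m::finite \<Rightarrow> real^'d \<Rightarrow> real^'d"
  assumes st: "steering \<Omega> g T \<gamma>" and g: "\<And>i. continuous_on \<Omega> (g i)"
  shows "trajectory_in \<Omega> g (\<lambda>t. \<gamma> (T * t))"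
proof -
  obtain u :: "real \<Rightarrow> real^'m" and N where u: "u \<in> borel_measurable borel" "bounded (range u)" "finite N"
    "\<And>t. t \<in> {0<..<T} - N \<Longrightarrow> (\<gamma> has_vector_derivative (\<Sum>i\<in>UNIV. u t $ i *\<^sub>R g i (\<gamma> t))) (at t)"
    using st unfolding steering_def by blast
  have \<gamma>: "0 < T" "continuous_on {0..T} \<gamma>" "\<gamma> ` {0..T} \<subseteq> \<Omega>"
    using st by (auto simp: steering_def)
  define \<sigma> where "\<sigma> t = \<gamma> (T * t)" for t
  define w where "w t = T *\<^sub>R u (T * t)" for t
  define \<sigma>' where "\<sigma>' t = (\<Sum>i\<in>UNIV. w t $ i *\<^sub>R g i (\<sigma> t))" for t
  define N' where "N' = (\<lambda>t. t / T) ` N"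
  have range: "T * t \<in> {0..T}" if "t \<in> {0..1}" for t
    using that \<gamma>(1) by (auto simp: mult_left_le)
  have \<sigma>\<Omega>: "\<sigma> t \<in> \<Omega>" if "t \<in> {0..1}" for t
    using range[OF that] \<gamma>(3) by (auto simp: \<sigma>_def)
  have cont\<sigma>: "continuous_on {0..1} \<sigma>"
    unfolding \<sigma>_def by (rule continuous_on_compose2[OF \<gamma>(2)]) (use range in \<open>auto intro!: continuous_intros\<close>)
  have contg: "continuous_on {0..1} (\<lambda>t. g i (\<sigma> t))" for i
    by (rule continuous_on_compose2[OF g cont\<sigma>]) (use \<sigma>\<Omega> in auto)
  obtain U where U: "\<And>t. norm (u t) \<le> U" using u(2) by (auto simp: bounded_iff)
  have wU: "\<bar>w t $ i\<bar> \<le> T * U" "norm (w t) \<le> T * U" for t i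
  proof -
    show "norm (w t) \<le> T * U" using U[of "T * t"] \<gamma>(1) by (simp add: w_def mult_left_mono)
    then show "\<bar>w t $ i\<bar> \<le> T * U" using component_le_norm_cart[of "w t" i] by simp
  qed
  have "\<exists>G. \<forall>t\<in>{0..1}. norm (g i (\<sigma> t)) \<le> G" for i
    using compact_imp_bounded[OF compact_continuous_image[OF contg[of i]]] by (auto simp: bounded_iff)
  then obtain G where G: "\<And>i t. t \<in> {0..1} \<Longrightarrow> norm (g i (\<sigma> t)) \<le> G i" by metis
  define C where "C = (\<Sum>i\<in>UNIV. T * U * G i)"
  have bound: "norm (\<sigma>' t) \<le> C" if "t \<in> {0..1}" for t
    unfolding \<sigma>'_def C_def
    by (intro order_trans[OF norm_sum] sum_mono) (use wU(1) G[OF that] in \<open>auto intro!: mult_mono order_trans[OF abs_ge_zero wU(1)]\<close>)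
  have C0: "C \<ge> 0" using order_trans[OF norm_ge_zero bound[of 0]] by simp
  have der: "(\<sigma> has_vector_derivative \<sigma>' t) (at t)" if t: "t \<in> {0<..<1} - N'" for t
  proof -
    have "T * t \<notin> N" using t \<gamma>(1) by (auto simp: N'_def image_iff)
    then have "(\<gamma> has_vector_derivative (\<Sum>i\<in>UNIV. u (T * t) $ i *\<^sub>R g i (\<gamma> (T * t)))) (at (T * t))"
      using t \<gamma>(1) by (intro u) auto
    moreover have "((\<lambda>t. T * t) has_vector_derivative T) (at t)"
      using has_vector_derivative_mult_right[OF has_vector_derivative_id, of T "at t"] by simp
    ultimately have "(\<sigma> has_vector_derivative T *\<^sub>R (\<Sum>i\<in>UNIV. u (T * t) $ i *\<^sub>R g i (\<gamma> (T * t)))) (at t)"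
      unfolding \<sigma>_def using vector_diff_chain_at[of "\<lambda>t. T * t" T t \<gamma>]
      by (simp add: o_def)
    then show ?thesis by (simp add: \<sigma>'_def w_def \<sigma>_def scaleR_sum_right)
  qed
  have finN': "finite N'" using u(3) by (simp add: N'_def)
  have "abs_continuous_on {0..1} \<sigma>"
  proof (rule Lipschitz_imp_abs_continuous_on[OF C0])
    fix a b :: real assume ab: "a \<le> b" "{a..b} \<subseteq> {0..1}"
    have "(\<sigma>' has_integral (\<sigma> b - \<sigma> a)) {a..b}"
      using ab der by (intro fundamental_theorem_of_calculus_interior_strong[OF finN'] continuous_on_subset[OF cont\<sigma>]) auto
    from has_integral_bound_real[OF C0 finite.emptyI this] show "norm (\<sigma> b - \<sigma> a) \<le> C * (b - a)"
      using ab bound by auto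
  qed
  moreover have mw: "w \<in> borel_measurable (lebesgue_on {0<..<1})"
  proof -
    have [measurable]: "u \<in> borel_measurable borel" by fact
    have "w \<in> borel_measurable borel" unfolding w_def[abs_def] by measurable
    then show ?thesis by (intro measurable_restrict_space1 measurable_completion) simp
  qed
  then have "w \<in> L2_space {0<..<1}" by (rule bounded_in_L2_space[OF _ wU(2)]) auto
  moreover have "\<sigma>' \<in> L2_space {0<..<1}"
  proof (rule bounded_in_L2_space[where B = C])
    have [measurable]: "(\<lambda>t. g i (\<sigma> t)) \<in> borel_measurable (lebesgue_on {0<..<1})" for i
      by (intro continuous_imp_measurable_on_sets_lebesgue continuous_on_subset[OF contg]) auto
    have [measurable]: "(\<lambda>t. w t $ i) \<in> borel_measurable (lebesgue_on {0<..<1})" for i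
      using mw by (intro borel_measurable_continuous_on[OF _ mw] continuous_intros)
    show "\<sigma>' \<in> borel_measurable (lebesgue_on {0<..<1})"
      unfolding \<sigma>'_def[abs_def] by measurable
  qed (use bound in auto)
  moreover have "AE t in lebesgue_on {0<..<1}. (\<sigma> has_vector_derivative \<sigma>' t) (at t) \<and>
      \<sigma>' t = (\<Sum>i\<in>UNIV. w t $ i *\<^sub>R g i (\<sigma> t))"
  proof -
    have "AE t in lebesgue. t \<notin> N'"
      using negligible_finite[OF finN'] by (simp add: AE_not_in negligible_iff_null_sets)
    then have "AE t in lebesgue_on {0<..<1}. t \<notin> N'"
      by (subst AE_restrict_space_iff) auto
    then show ?thesis
      by (rule AE_mp) (rule AE_I2, use der in \<open>auto simp: \<sigma>'_def\<close>)
  qed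
  ultimately show ?thesis
    unfolding trajectory_in_def \<sigma>_def[abs_def, symmetric] using \<sigma>\<Omega> by blast
qed

lemma steering_constant: "x \<in> \<Omega> \<Longrightarrow> steering \<Omega> g 1 (\<lambda>t. x)"
  unfolding steering_def by (intro conjI exI[of _ "\<lambda>t. 0"] exI[of _ "{}"]) auto

text \<open>
  A point outside \<open>\<Omega>\<close> is an equilibrium, and by uniqueness an equilibrium is never reached from
  elsewhere.
\<close>
lemma ode_solution_stays:
  fixes X :: "'a::euclidean_space \<Rightarrow> 'a"
  assumes lip: "L-lipschitz_on UNIV X" and h: "h * L \<le> 1 / 2" and p: "solves_ode X h p"
    and zero: "\<And>x. x \<notin> \<Omega> \<Longrightarrow> X x = 0" and start: "p 0 \<in> \<Omega>" and t: "t \<in> {0..h}"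
  shows "p t \<in> \<Omega>"
proof (rule ccontr)
  assume out: "p t \<notin> \<Omega>"
  then have "solves_ode X h (\<lambda>_. p t)" using zero by (simp add: solves_ode_def)
  from ode_solutions_stable[OF lip h p this t, of 0] have "p 0 = p t" using t by simp
  with start out show False by simp
qed

text \<open>
  Moving along \<open>c \<phi> g\<^sub>i\<close> means using the feedback control \<open>c \<phi>(p t)\<close> on the \<open>i\<close>-th field.
\<close>
lemma steering_along_field:
  fixes g :: "'m::finite \<Rightarrow> real^'d::finite \<Rightarrow> real^'d"
  assumes p: "solves_ode (\<lambda>x. c *\<^sub>R (\<phi> x *\<^sub>R g i x)) h p" and h: "h > 0"
    and \<phi>: "continuous_on UNIV \<phi>" "\<And>x. \<bar>\<phi> x\<bar> \<le> B"
    and stays: "\<And>t. t \<in> {0..h} \<Longrightarrow> p t \<in> \<Omega>"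
  shows "steering \<Omega> g h p"
proof -
  let ?u = "\<lambda>t. (c * \<phi> (p t)) *\<^sub>R axis i 1 :: real^'m"
  have cp: "continuous_on UNIV p" using p by (simp add: solves_ode_def)
  have "?u \<in> borel_measurable borel"
    by (intro borel_measurable_continuous_onI continuous_intros continuous_on_compose2[OF \<phi>(1) cp]) auto
  moreover have "bounded (range ?u)"
    unfolding bounded_iff
    by (rule exI[of _ "\<bar>c\<bar> * B"]) (use \<phi>(2) in \<open>auto simp: abs_mult mult_left_mono\<close>)
  moreover have "(p has_vector_derivative (\<Sum>k\<in>UNIV. ?u t $ k *\<^sub>R g k (p t))) (at t)" if t: "t \<in> {0<..<h} - {}" for t
  proof -
    have "(p has_vector_derivative c *\<^sub>R (\<phi> (p t) *\<^sub>R g i (p t))) (at t within {0..h})"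
      using p t by (simp add: solves_ode_def)
    moreover have "at t within {0..h} = at t" using t by (intro at_within_interior) auto
    moreover have "(\<Sum>k\<in>UNIV. ?u t $ k *\<^sub>R g k (p t)) = c *\<^sub>R (\<phi> (p t) *\<^sub>R g i (p t))"
      by (subst sum.remove[of _ i]) (auto simp: axis_def intro!: sum.neutral)
    ultimately show ?thesis by simp
  qed
  ultimately show ?thesis
    unfolding steering_def using h stays continuous_on_subset[OF cp]
    by (intro conjI exI[of _ ?u] exI[of _ "{}"]) auto
qed

text \<open>
  The time-\<open>h\<close> map is continuous and injective, so by invariance of domain the image of the interior is
  an open set, and it lies in \<open>R\<close>.
\<close>
lemma interior_invariant:
  fixes X :: "'a::euclidean_space \<Rightarrow> 'a"
  assumes lip: "L-lipschitz_on UNIV X" and h: "h > 0" "h * L \<le> 1 / 2"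
    and inv: "\<And>p. solves_ode X h p \<Longrightarrow> p 0 \<in> R \<Longrightarrow> p h \<in> R"
    and p: "solves_ode X h p" "p 0 \<in> interior R"
  shows "p h \<in> interior R"
proof -
  have "\<exists>q. solves_ode X h q \<and> q 0 = z" for z
    using ode_solution_exists[OF lip, of h z] h by (metis less_imp_le)
  then obtain q where q: "\<And>z. solves_ode X h (q z)" "\<And>z. q z 0 = z" by metis
  have end_le: "dist (q z h) (q z' h) \<le> 2 * dist z z'" for z z'
    using ode_solutions_stable[OF lip h(2) q(1) q(1), of 0 h z z'] h by (simp add: q(2))
  have start_le: "dist z z' \<le> 2 * dist (q z h) (q z' h)" for z z'
    using ode_solutions_stable[OF lip h(2) q(1) q(1), of h 0 z z'] h by (simp add: q(2))
  have "open ((\<lambda>z. q z h) ` interior R)"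
  proof (rule invariance_of_domain)
    have "2-lipschitz_on (interior R) (\<lambda>z. q z h)"
      by (rule lipschitz_onI) (use end_le in auto)
    then show "continuous_on (interior R) (\<lambda>z. q z h)" by (rule lipschitz_on_continuous_on)
    show "inj_on (\<lambda>z. q z h) (interior R)"
    proof (rule inj_onI)
      fix x y assume "q x h = q y h"
      then show "x = y" using start_le[of x y] by simp
    qed
  qed simp
  moreover have "(\<lambda>z. q z h) ` interior R \<subseteq> R"
    using inv[OF q(1)] q(2) interior_subset by auto
  ultimately have "(\<lambda>z. q z h) ` interior R \<subseteq> interior R" by (rule interior_maximal[rotated])
  moreover have "p h = q (p 0) h"
    using ode_solutions_stable[OF lip h(2) p(1) q(1), of 0 h "p 0"] h by (simp add: q(2))
  ultimately show ?thesis using p(2) by auto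
qed

section \<open>Weak derivatives of indicators of flow-invariant sets\<close>

text \<open>
  Invariance under the flows of all fields \<open>\<plusminus>\<phi> g\<^sub>i\<close>, for times that are short compared with a Lipschitz
  constant of the field; the two signs encode forward and backward motion.
\<close>
definition flow_invariant :: "(real^'d::finite) set \<Rightarrow> ('m::finite \<Rightarrow> real^'d \<Rightarrow> real^'d) \<Rightarrow>
    (real^'d) set \<Rightarrow> bool" where
  "flow_invariant \<Omega> g A \<longleftrightarrow> (\<forall>i. \<forall>\<phi>\<in>test_functions \<Omega>. \<forall>L s h p.
     L-lipschitz_on UNIV (\<lambda>x. \<phi> x *\<^sub>R g i x) \<longrightarrow> \<bar>s\<bar> = 1 \<longrightarrow> 0 < h \<longrightarrow> h * L \<le> 1 / 2 \<longrightarrow>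
     solves_ode (\<lambda>x. s *\<^sub>R (\<phi> x *\<^sub>R g i x)) h p \<longrightarrow> p 0 \<in> A \<longrightarrow> p h \<in> A)"

text \<open>
  A subset of the reachable set that is large enough for the argument and whose members are described
  by concatenable curves.
\<close>
definition steered_set :: "(real^'d::finite) set \<Rightarrow> ('m::finite \<Rightarrow> real^'d \<Rightarrow> real^'d) \<Rightarrow>
    (real^'d) set \<Rightarrow> (real^'d) set" where
  "steered_set \<Omega> g B = {z. \<exists>T \<gamma>. steering \<Omega> g T \<gamma> \<and> \<gamma> 0 \<in> B \<and> \<gamma> T = z}"

lemma steered_set_subset_Reach:
  assumes "\<And>i. continuous_on \<Omega> (g i)"
  shows "steered_set \<Omega> g B \<subseteq> Reach \<Omega> g B"
proof
  fix z assume "z \<in> steered_set \<Omega> g B"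
  then obtain T \<gamma> where \<gamma>: "steering \<Omega> g T \<gamma>" "\<gamma> 0 \<in> B" "\<gamma> T = z"
    by (auto simp: steered_set_def)
  have "trajectory_in \<Omega> g (\<lambda>t. \<gamma> (T * t))" using \<gamma>(1) assms by (rule steering_imp_trajectory)
  moreover have "z \<in> \<Omega>" using \<gamma> by (auto simp: steering_def)
  ultimately show "z \<in> Reach \<Omega> g B" unfolding Reach_def using \<gamma> by (auto intro!: exI[of _ "\<lambda>t. \<gamma> (T * t)"])
qed

lemma steered_set_subset: "steered_set \<Omega> g B \<subseteq> \<Omega>"
  by (auto simp: steered_set_def steering_def)

lemma subset_steered_set: "B \<inter> \<Omega> \<subseteq> steered_set \<Omega> g B"
  unfolding steered_set_def using steering_constant[of _ \<Omega> g] by fastforce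

lemma test_function_zero_outside: "\<phi> \<in> test_functions \<Omega> \<Longrightarrow> x \<notin> \<Omega> \<Longrightarrow> \<phi> x = 0"
  using closure_subset[of "{x. \<phi> x \<noteq> 0}"] by (auto simp: test_functions_def)

lemma flow_invariant_whole: "flow_invariant \<Omega> g \<Omega>"
  unfolding flow_invariant_def
proof (intro allI ballI impI)
  fix i \<phi> L s h p
  assume \<phi>: "\<phi> \<in> test_functions \<Omega>" and lip: "L-lipschitz_on UNIV (\<lambda>x. \<phi> x *\<^sub>R g i x)"
    and s: "\<bar>s\<bar> = (1::real)" and h: "0 < h" "h * L \<le> 1 / 2"
    and p: "solves_ode (\<lambda>x. s *\<^sub>R (\<phi> x *\<^sub>R g i x)) h p" "p 0 \<in> \<Omega>"
  have lip': "L-lipschitz_on UNIV (\<lambda>x. s *\<^sub>R (\<phi> x *\<^sub>R g i x))"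
    using lipschitz_on_cmult[OF lip, of s] s by simp
  show "p h \<in> \<Omega>"
    by (rule ode_solution_stays[OF lip' h(2) p(1) _ p(2)]) (use test_function_zero_outside[OF \<phi>] h in auto)
qed

text \<open>
  A curve that steers to the start of a flow line can be prolonged along the flow line, which stays in
  \<open>\<Omega>\<close>.  So the steered set is invariant, and invariance passes to its interior.
\<close>
lemma flow_invariant_interior_steered_set: "flow_invariant \<Omega> g (interior (steered_set \<Omega> g B))"
  unfolding flow_invariant_def
proof (intro allI ballI impI)
  fix i \<phi> L s h p
  assume \<phi>: "\<phi> \<in> test_functions \<Omega>" and lip: "L-lipschitz_on UNIV (\<lambda>x. \<phi> x *\<^sub>R g i x)"
    and s: "\<bar>s\<bar> = (1::real)" and h: "0 < h" "h * L \<le> 1 / 2"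
    and p: "solves_ode (\<lambda>x. s *\<^sub>R (\<phi> x *\<^sub>R g i x)) h p" "p 0 \<in> interior (steered_set \<Omega> g B)"
  let ?X = "\<lambda>x. s *\<^sub>R (\<phi> x *\<^sub>R g i x)"
  have lip': "L-lipschitz_on UNIV ?X"
    using lipschitz_on_cmult[OF lip, of s] s by simp
  have cont: "continuous_on UNIV \<phi>"
    using \<phi> by (auto simp: test_functions_def dest: spec[of _ 0])
  have "compact (closure {x. \<phi> x \<noteq> 0})" using \<phi> by (simp add: test_functions_def)
  then obtain C where C: "\<And>x. norm (\<phi> x) \<le> C"
    using bounded_range_compact_support[OF _ cont] closure_subset[of "{x. \<phi> x \<noteq> 0}"] by blast
  show "p h \<in> interior (steered_set \<Omega> g B)"
  proof (rule interior_invariant[OF lip' h _ p])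
    fix q assume q: "solves_ode ?X h q" "q 0 \<in> steered_set \<Omega> g B"
    then have start: "q 0 \<in> \<Omega>" using steered_set_subset by blast
    have "q t \<in> \<Omega>" if "t \<in> {0..h}" for t
      by (rule ode_solution_stays[OF lip' h(2) q(1) _ start that]) (use test_function_zero_outside[OF \<phi>] in auto)
    then have leg: "steering \<Omega> g h q"
      using C by (intro steering_along_field[where c = s and \<phi> = \<phi> and g = g and i = i, OF q(1) h(1) cont]) auto
    obtain T \<gamma> where \<gamma>: "steering \<Omega> g T \<gamma>" "\<gamma> 0 \<in> B" "\<gamma> T = q 0"
      using q(2) by (auto simp: steered_set_def)
    have "T > 0" using \<gamma>(1) by (simp add: steering_def)
    then show "q h \<in> steered_set \<Omega> g B"
      unfolding steered_set_def using steering_append[OF \<gamma>(1) leg \<gamma>(3)] h \<gamma>(2)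
      by (intro CollectI exI conjI) (assumption | auto)+
  qed
qed

text \<open>
  This says that the indicator of a flow-invariant open set has weak derivative zero along \<open>g\<^sub>i\<close>.
  Besides the interior of the steered set it is applied to \<open>\<Omega>\<close> itself, whose indicator represents the
  constants.
\<close>
lemma integral_adjoint_flow_invariant:
  fixes g :: "'m::finite \<Rightarrow> real^'d::finite \<Rightarrow> real^'d"
  assumes "open \<Omega>" and g: "Ck_on 2 \<Omega> (g i)" and \<phi>: "\<phi> \<in> test_functions \<Omega>"
    and A: "open A" "bounded A" "A \<subseteq> \<Omega>" "flow_invariant \<Omega> g A"
  shows "integrable (lebesgue_on \<Omega>) (\<lambda>x. indicator A x * field_adjoint (g i) \<phi> x)"
    and "(LINT x|lebesgue_on \<Omega>. indicator A x * field_adjoint (g i) \<phi> x) = 0"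
proof -
  let ?Y = "\<lambda>x. \<phi> x *\<^sub>R g i x" and ?K = "closure {x. \<phi> x \<noteq> 0}"
  let ?D = "\<lambda>x. frechet_derivative ?Y (at x)"
  let ?div = "\<lambda>x. \<Sum>i\<in>UNIV. ?D x (axis i 1) $ i"
  have C2: "Ck_on 2 UNIV ?Y" using assms by (intro test_function_times_field_C2)
  have K: "compact ?K" using \<phi> by (simp add: test_functions_def)
  have zero: "?Y x = 0" if "x \<notin> ?K" for x
    using that closure_subset[of "{x. \<phi> x \<noteq> 0}"] by auto
  obtain L M B where props: "\<And>x. (?Y has_derivative ?D x) (at x)" "L-lipschitz_on UNIV ?Y"
    "M-lipschitz_on UNIV (\<lambda>x. ?D x (?Y x))" "\<And>x i j. \<bar>?D x (axis j 1) $ i\<bar> \<le> B"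
    "continuous_on UNIV ?div"
    by (rule C2_compact_support_field[OF C2 K zero]) (assumption, rule that)
  have adj: "field_adjoint (g i) \<phi> x = - ?div x" for x
    by (rule field_adjoint_eq_divergence[OF props(1)])
  have zero_int: "(LINT x|lborel. indicator A x * ?div x) = 0"
    using A(4) \<phi> props(2)
    by (intro divergence_integral_zero[OF A(1,2) props(1-5)]) (simp add: flow_invariant_def)
  let ?f = "\<lambda>x. indicator A x * ?div x"
  have [measurable]: "?div \<in> borel_measurable borel"
    using props(5) by (rule borel_measurable_continuous_onI)
  have [measurable]: "A \<in> sets borel" using A(1) by simp
  have "integrable lborel (\<lambda>x. indicator A x *\<^sub>R ?div x)"
  proof (rule integrableI_bounded_set_indicator[where B = "CARD('d) * B"])
    show "emeasure lborel A < \<infinity>" using A(2) by (rule emeasure_bounded_finite)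
    have "norm (?div x) \<le> CARD('d) * B" for x
    proof -
      have "norm (?div x) \<le> (\<Sum>i\<in>UNIV. \<bar>?D x (axis i 1) $ i\<bar>)" by (simp add: sum_abs)
      also have "\<dots> \<le> (\<Sum>i\<in>(UNIV :: 'd set). B)" by (intro sum_mono props(4))
      finally show ?thesis by simp
    qed
    then show "AE x in lborel. x \<in> A \<longrightarrow> norm (?div x) \<le> CARD('d) * B" by simp
  qed (use A in auto)
  then have int: "integrable lborel ?f" by simp
  have restrict: "indicator \<Omega> x *\<^sub>R (indicator A x * field_adjoint (g i) \<phi> x) = - ?f x" for x
    using A(3) by (auto simp: adj indicator_def)
  have \<Omega>: "\<Omega> \<inter> space lebesgue \<in> sets lebesgue" using \<open>open \<Omega>\<close> by auto
  show "integrable (lebesgue_on \<Omega>) (\<lambda>x. indicator A x * field_adjoint (g i) \<phi> x)"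
    unfolding integrable_restrict_space[OF \<Omega>] restrict
    using int by (simp add: integrable_completion)
  show "(LINT x|lebesgue_on \<Omega>. indicator A x * field_adjoint (g i) \<phi> x) = 0"
    unfolding integral_restrict_space[OF \<Omega>] restrict
    using zero_int by (simp add: integral_completion)
qed

section \<open>Reachable sets have full measure\<close>

theorem theorem3p2:
  fixes \<Omega> :: "(real^'d::finite) set"
    and g :: "'m::finite \<Rightarrow> real^'d \<Rightarrow> real^'d"
    and R :: real and y :: "real^'d"
  assumes "open \<Omega>" and "bounded \<Omega>" and "\<Omega> \<noteq> {}"
    and "CARD('m) \<le> CARD('d)"
    and "\<And>i. C2_closure \<Omega> (g i)"
    and "\<And>u. u \<in> L2_perp \<Omega> \<Longrightarrow> has_sub_laplacian \<Omega> g u (\<lambda>x. 0) \<Longrightarrow>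
           (AE x in lebesgue_on \<Omega>. u x = 0)"
    and "R > 0" and "y \<in> \<Omega>"
  shows "\<Omega> - Reach \<Omega> g (ball y R) \<in> null_sets lebesgue"
proof -
  define A where "A = interior (steered_set \<Omega> g (ball y R))"
  have C2: "Ck_on 2 \<Omega> (g i)" for i using assms(5) by (simp add: C2_closure_def)
  have contg: "continuous_on \<Omega> (g i)" for i
    using Ck_on_SucD[of 1 \<Omega> "g i"] Ck_on_SucD[of 0 \<Omega> "g i"] C2[of i] by (simp add: numeral_2_eq_2)
  have A: "open A" "A \<subseteq> \<Omega>" "A \<subseteq> Reach \<Omega> g (ball y R)"
    using interior_subset steered_set_subset steered_set_subset_Reach[of \<Omega> g "ball y R"] contg
    unfolding A_def by blast+
  have bA: "bounded A" using A(2) assms(2) by (rule bounded_subset[rotated])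
  have ballA: "ball y R \<inter> \<Omega> \<subseteq> A"
    unfolding A_def using assms(1) by (intro interior_maximal subset_steered_set) auto
  have yA: "y \<in> A" using ballA assms(7,8) by auto
  have m\<Omega>: "\<Omega> \<in> lmeasurable" using assms(1,2) by (simp add: bounded_set_imp_lmeasurable)
  have mA: "A \<in> lmeasurable" using A(1) bA by (simp add: bounded_set_imp_lmeasurable)
  have \<Omega>': "\<Omega> \<inter> space lebesgue \<in> sets lebesgue" using m\<Omega> by auto
  define c where "c = measure lebesgue A / measure lebesgue \<Omega>"
  \<comment> \<open>The constant is written as a multiple of \<open>1\<^sub>\<Omega>\<close>, so that both terms of \<open>u\<close> are indicators of
      flow-invariant open sets.\<close>
  define u where "u x = indicator A x - c * indicator \<Omega> x" for x
  have pos\<Omega>: "measure lebesgue \<Omega> > 0"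
    using assms(1,3) m\<Omega> open_not_negligible negligible_iff_measure[of \<Omega>] by (auto simp: zero_less_measure_iff)
  have intA: "integrable (lebesgue_on \<Omega>) (indicator A :: _ \<Rightarrow> real)"
    and int\<Omega>: "integrable (lebesgue_on \<Omega>) (indicator \<Omega> :: _ \<Rightarrow> real)"
    and valA: "(LINT x|lebesgue_on \<Omega>. indicator A x) = measure lebesgue A"
    and val\<Omega>: "(LINT x|lebesgue_on \<Omega>. indicator \<Omega> x) = measure lebesgue \<Omega>"
  proof -
    have fin: "S \<in> sets (lebesgue_on \<Omega>)" "emeasure (lebesgue_on \<Omega>) S < \<infinity>"
      "measure (lebesgue_on \<Omega>) S = measure lebesgue S" "S \<inter> space (lebesgue_on \<Omega>) = S"
      if "S \<in> lmeasurable" "S \<subseteq> \<Omega>" for S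
      using that \<Omega>' by (auto simp: sets_restrict_space_iff emeasure_restrict_space measure_restrict_space
          fmeasurable_def space_restrict_space)
    show "integrable (lebesgue_on \<Omega>) (indicator A :: _ \<Rightarrow> real)" "(LINT x|lebesgue_on \<Omega>. indicator A x) = measure lebesgue A"
      using fin[OF mA A(2)] by simp_all
    show "integrable (lebesgue_on \<Omega>) (indicator \<Omega> :: _ \<Rightarrow> real)" "(LINT x|lebesgue_on \<Omega>. indicator \<Omega> x) = measure lebesgue \<Omega>"
      using fin[OF m\<Omega> order_refl] by simp_all
  qed
  have um: "u \<in> borel_measurable (lebesgue_on \<Omega>)"
    unfolding u_def[abs_def] using intA int\<Omega> by (intro borel_measurable_diff borel_measurable_times) auto
  have uL2: "u \<in> L2_space \<Omega>"
    by (rule bounded_in_L2_space[OF um _ m\<Omega>, where B = "1 + \<bar>c\<bar>"]) (auto simp: u_def indicator_def)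
  have "(LINT x|lebesgue_on \<Omega>. u x) = 0"
  proof -
    have "(LINT x|lebesgue_on \<Omega>. u x) = (LINT x|lebesgue_on \<Omega>. indicator A x) - (LINT x|lebesgue_on \<Omega>. c * indicator \<Omega> x)"
      unfolding u_def using intA int\<Omega> by (intro Bochner_Integration.integral_diff) auto
    also have "(LINT x|lebesgue_on \<Omega>. c * indicator \<Omega> x) = c * (LINT x|lebesgue_on \<Omega>. indicator \<Omega> x)"
      by (rule integral_mult_right_zero)
    finally show ?thesis unfolding valA val\<Omega> using pos\<Omega> by (simp add: c_def)
  qed
  then have perp: "u \<in> L2_perp \<Omega>" using uL2 by (simp add: L2_perp_def)
  have zeroL2: "(\<lambda>x. 0 :: real) \<in> L2_space \<Omega>" by (simp add: L2_space_def)
  have weak: "has_weak_deriv \<Omega> (g i) u (\<lambda>x. 0)" for i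
    unfolding has_weak_deriv_def
  proof (intro conjI ballI uL2 zeroL2)
    fix \<phi> assume \<phi>: "\<phi> \<in> test_functions \<Omega>"
    let ?a = "field_adjoint (g i) \<phi>"
    note 1 = integral_adjoint_flow_invariant[of \<Omega> g i \<phi> A, OF assms(1) C2 \<phi> A(1) bA A(2)
        flow_invariant_interior_steered_set[of \<Omega> g "ball y R", folded A_def]]
    note 2 = integral_adjoint_flow_invariant[of \<Omega> g i \<phi> \<Omega>, OF assms(1) C2 \<phi> assms(1,2) order_refl flow_invariant_whole]
    have "(LINT x|lebesgue_on \<Omega>. u x * ?a x)
        = (LINT x|lebesgue_on \<Omega>. indicator A x * ?a x - c * (indicator \<Omega> x * ?a x))"
      by (simp add: u_def algebra_simps)
    also have "\<dots> = 0" using 1 2 by simp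
    finally show "(LINT x|lebesgue_on \<Omega>. 0 * \<phi> x) = (LINT x|lebesgue_on \<Omega>. u x * ?a x)" by simp
  qed
  have "has_sub_laplacian \<Omega> g u (\<lambda>x. 0)"
    unfolding has_sub_laplacian_def
  proof (intro conjI bexI[of _ "\<lambda>x. 0"] ballI zeroL2)
    show "u \<in> WH1 \<Omega> g" using uL2 weak by (auto simp: WH1_def)
    fix \<psi> assume "\<psi> \<in> WH1 \<Omega> g"
    then obtain v where "\<And>i. has_weak_deriv \<Omega> (g i) \<psi> (v i)" by (auto simp: WH1_def) metis
    then show "has_sigma \<Omega> g u \<psi> (L2_inner \<Omega> (\<lambda>x. 0) \<psi>)"
      unfolding has_sigma_def using weak
      by (intro exI[of _ "\<lambda>i x. 0"] exI[of _ v]) (simp add: L2_inner_def)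
  qed simp
  then have AE0: "AE x in lebesgue_on \<Omega>. u x = 0" using perp assms(6) by blast
  then have AE: "AE x in lebesgue. x \<in> \<Omega> \<longrightarrow> u x = 0"
    using \<Omega>' by (simp add: AE_restrict_space_iff)
  \<comment> \<open>Off \<open>A\<close> the value of \<open>u\<close> is \<open>- c\<close> and on \<open>A\<close> it is \<open>1 - c\<close>; the latter must vanish because \<open>A\<close> is
      not a null set.\<close>
  have "c = 1"
  proof (rule ccontr)
    assume "c \<noteq> 1"
    then have "AE x in lebesgue. x \<notin> A"
      using AE A(2) by (auto simp: u_def elim!: eventually_mono)
    then have "A \<in> null_sets lebesgue" using mA by (simp add: AE_iff_null_sets fmeasurable_def)
    then show False using open_not_negligible[OF A(1)] yA by (auto simp: negligible_iff_null_sets)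
  qed
  from this have "AE x in lebesgue. x \<notin> \<Omega> - A"
    using AE by (auto simp: u_def elim!: eventually_mono split: split_indicator_asm)
  moreover have "\<Omega> - A \<in> sets lebesgue"
    using mA m\<Omega> by (intro sets.Diff) (auto dest: fmeasurableD)
  ultimately have "\<Omega> - A \<in> null_sets lebesgue"
    by (simp add: AE_iff_null_sets)
  then show ?thesis
    by (rule null_sets_completion_subset[rotated]) (use A(3) in auto)
qed

end
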